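(* Let $\Omega\subset\mathbb{R}^d$ be compact and convex, and let $\mu_i=\sum_{j=1}^{m_i}u_{i,j}\delta_{x_{i,j}}$, $i=1,\dots,n$, be discrete probability measures with $x_{i,j}\in\Omega$. Let $w_1,\dots,w_n\ge0$ with $\sum_{i=1}^n w_i=1$, let $\mathcal{E}(\lambda)=\sum_{i=1}^n\frac{w_i}{2}W_2^2(\mu_i,\lambda)$ for $\lambda\in\mathcal{P}(\Omega)$, and let $\lambda^\star\in\arg\min_{\lambda\in\mathcal{P}(\Omega)}\mathcal{E}(\lambda)$. Assume that there exists $r>0$ such that $\operatorname{dist}(x_{i,j},\partial\Omega)\ge r$ for all $i,j$. Let $\lambda^0\in\mathcal{P}_{\mathrm{ac}}(\Omega)$ have density $\rho^0$ with $0<a\le\rho^0(x)\le b<\infty$ for all $x\in\Omega$, and let $\lambda^k$, with density $\rho^k$ on $\Omega$, be the iterates of the mirror descent algorithm $$\rho^{k+1}\propto\rho^k\exp\Big(-\eta_k\sum_{i=1}^n w_i\,\phi_{\rho^k\to\mu_i}\Big),$$ where $\phi_{\rho^k\to\mu_i}$ is a Kantorovich potential from $\lambda^k$ to $\mu_i$ and $\propto$ means normalization to a probability density on $\Omega$. Suppose the algorithm is run for $T\ge 4d/r^2$ iterations, with step sizes either $\eta_k=1/\sqrt{k+1}$ for all $k$, or $\eta_k=1/\sqrt{T}$ for all $k$. Then $$\min_{0\le k\le T}\bigl(\mathcal{E}(\lambda^k)-\mathcal{E}(\lambda^\star)\bigr)=O\left(\frac{\log T}{\sqrt{T}}\right),$$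 that is, for each of the two step-size choices there is a constant $C$ independent of $T$ such that the left-hand side is at most $C\log T/\sqrt{T}$ for all integers $T\ge\max\{2,4d/r^2\}$.
   Context: $\mathcal{P}(\Omega)$ is the set of Borel probability measures supported on $\Omega$, and $\mathcal{P}_{\mathrm{ac}}(\Omega)$ the subset of those absolutely continuous with respect to Lebesgue measure. $\|\cdot\|$ is the Euclidean norm, $\partial\Omega$ is the boundary of $\Omega$, and $\operatorname{dist}(x,\partial\Omega)=\inf_{y\in\partial\Omega}\|x-y\|$. The weights of each discrete measure satisfy $u_{i,j}\ge0$ and $\sum_j u_{i,j}=1$. The 2-Wasserstein distance is $W_2^2(\mu,\nu)=\inf_{\pi\in\Pi(\mu,\nu)}\int\|x-y\|^2\,d\pi(x,y)$, where $\Pi(\mu,\nu)$ is the set of couplings of $\mu$ and $\nu$. Kantorovich potentials in the semi-discrete setting: for a density $\rho$ on $\Omega$ and $\mu=\sum_{j=1}^m u_j\delta_{x_j}$, let $(\phi_1,\dots,\phi_m)\in\mathbb{R}^m$ maximize $\sum_{j}u_j\phi_j+\int_\Omega\min_{j}\{\|y-x_j\|^2/2-\phi_j\}\rho(y)\,dy$ (the maximum equals $\frac12W_2^2$ between $\mu$ and the measure with density $\rho$); then $\phi_{\rho\to\mu}(y)=\min_{1\le j\le m}\{\|y-x_j\|^2/2-\phi_j\}$, $y\in\Omega$, is the Kantorovich potential from $\rho$ to $\mu$. It is normalized by an additive constant so that $\inf_{\Omega}\phi_{\rho\to\mu}=0$ (the density update is invariant under adding constants to the potentials). *)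

theory Defs
  imports "HOL-Probability.Probability"
begin

definition prob_measures_on :: "'a::euclidean_space set \<Rightarrow> 'a measure set" where
  "prob_measures_on \<Omega> = {\<mu>. prob_space \<mu> \<and> sets \<mu> = sets borel \<and> emeasure \<mu> (- \<Omega>) = 0}"

definition ac_prob_measures_on :: "'a::euclidean_space set \<Rightarrow> 'a measure set" where
  "ac_prob_measures_on \<Omega> = {\<mu> \<in> prob_measures_on \<Omega>. absolutely_continuous lborel \<mu>}"

definition has_density_on :: "'a::euclidean_space set \<Rightarrow> 'a measure \<Rightarrow> ('a \<Rightarrow> real) \<Rightarrow> bool" where
  "has_density_on \<Omega> \<mu> \<rho> \<longleftrightarrow>
     set_borel_measurable borel \<Omega> \<rho> \<and> (\<forall>y\<in>\<Omega>. 0 \<le> \<rho> y) \<and>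
     \<mu> = density lborel (\<lambda>y. ennreal (indicator \<Omega> y * \<rho> y))"

text \<open>The measure \<open>\<Sum>j=1..m. u j \<cdot> \<delta>\<^bsub>x j\<^esub>\<close>, built as the image under \<open>x\<close> of the measure on the
  index set \<open>{1..m}\<close> with point masses \<open>u j\<close>; the points \<open>x j\<close> need not be distinct.\<close>

definition discrete_measure :: "nat \<Rightarrow> (nat \<Rightarrow> real) \<Rightarrow> (nat \<Rightarrow> 'a::euclidean_space) \<Rightarrow> 'a measure" where
  "discrete_measure m u x = distr (point_measure {1..m} (\<lambda>j. ennreal (u j))) borel x"

lemma emeasure_discrete_measure:
  fixes x :: "nat \<Rightarrow> 'a::euclidean_space"
  assumes "A \<in> sets borel"
  shows "emeasure (discrete_measure m u x) A =
           (\<Sum>j=1..m. ennreal (u j) * emeasure (return borel (x j)) A)"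
proof -
  have "emeasure (discrete_measure m u x) A =
          emeasure (point_measure {1..m} (\<lambda>j. ennreal (u j))) {j\<in>{1..m}. x j \<in> A}"
    unfolding discrete_measure_def using assms
    by (subst emeasure_distr) (auto simp: space_point_measure intro!: arg_cong2[where f = emeasure])
  also have "\<dots> = (\<Sum>j | j \<in> {1..m} \<and> x j \<in> A. ennreal (u j))"
    by (subst emeasure_point_measure_finite) auto
  also have "\<dots> = (\<Sum>j=1..m. if x j \<in> A then ennreal (u j) else 0)"
    by (subst sum.inter_filter [symmetric]) auto
  also have "\<dots> = (\<Sum>j=1..m. ennreal (u j) * emeasure (return borel (x j)) A)"
    using assms by (intro sum.cong) (auto simp: indicator_def)
  finally show ?thesis .
qed

definition couplings :: "'a::euclidean_space measure \<Rightarrow> 'a measure \<Rightarrow> ('a \<times> 'a) measure set" where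
  "couplings \<mu> \<nu> =
     {\<pi>. sets \<pi> = sets borel \<and> distr \<pi> borel fst = \<mu> \<and> distr \<pi> borel snd = \<nu>}"

text \<open>The infimum is taken in \<^typ>\<open>ennreal\<close>. It is finite for measures with finite second moment, in
  particular for probability measures supported on a compact set, so that \<^const>\<open>enn2real\<close> loses
  nothing there.\<close>

definition W2_sq :: "'a::euclidean_space measure \<Rightarrow> 'a measure \<Rightarrow> real" where
  "W2_sq \<mu> \<nu> =
     enn2real (INF \<pi>\<in>couplings \<mu> \<nu>. \<integral>\<^sup>+ (x, y). ennreal ((norm (x - y))\<^sup>2) \<partial>\<pi>)"

definition barycenter_functional ::
    "nat \<Rightarrow> (nat \<Rightarrow> real) \<Rightarrow> (nat \<Rightarrow> 'a::euclidean_space measure) \<Rightarrow> 'a measure \<Rightarrow> real" where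
  "barycenter_functional n w \<mu> \<nu> = (\<Sum>i=1..n. w i / 2 * W2_sq (\<mu> i) \<nu>)"

definition semidiscrete_transform ::
    "nat \<Rightarrow> (nat \<Rightarrow> 'a::euclidean_space) \<Rightarrow> (nat \<Rightarrow> real) \<Rightarrow> 'a \<Rightarrow> real" where
  "semidiscrete_transform m x \<phi> y = (MIN j\<in>{1..m}. (norm (y - x j))\<^sup>2 / 2 - \<phi> j)"

definition semidiscrete_dual ::
    "'a::euclidean_space set \<Rightarrow> ('a \<Rightarrow> real) \<Rightarrow> nat \<Rightarrow> (nat \<Rightarrow> real) \<Rightarrow> (nat \<Rightarrow> 'a) \<Rightarrow>
     (nat \<Rightarrow> real) \<Rightarrow> real" where
  "semidiscrete_dual \<Omega> \<rho> m u x \<phi> =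
     (\<Sum>j=1..m. u j * \<phi> j) + (LINT y:\<Omega>|lborel. semidiscrete_transform m x \<phi> y * \<rho> y)"

text \<open>\<open>f\<close> is a Kantorovich potential from \<open>\<rho>\<close> to \<open>\<Sum>j=1..m. u j \<cdot> \<delta>\<^bsub>x j\<^esub>\<close>, normalized to have
  infimum \<open>0\<close> on \<open>\<Omega>\<close>. Only the values of \<open>f\<close> on \<open>\<Omega>\<close> matter. A maximizer need not be unique.\<close>

definition kantorovich_potential ::
    "'a::euclidean_space set \<Rightarrow> ('a \<Rightarrow> real) \<Rightarrow> nat \<Rightarrow> (nat \<Rightarrow> real) \<Rightarrow> (nat \<Rightarrow> 'a) \<Rightarrow>
     ('a \<Rightarrow> real) \<Rightarrow> bool" where
  "kantorovich_potential \<Omega> \<rho> m u x f \<longleftrightarrow>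
     (\<exists>\<phi>. (\<forall>\<psi>. semidiscrete_dual \<Omega> \<rho> m u x \<psi> \<le> semidiscrete_dual \<Omega> \<rho> m u x \<phi>) \<and>
          (\<forall>y\<in>\<Omega>. f y = semidiscrete_transform m x \<phi> y)) \<and>
     (INF y\<in>\<Omega>. f y) = 0"

definition mirror_descent_step ::
    "'a::euclidean_space set \<Rightarrow> nat \<Rightarrow> (nat \<Rightarrow> real) \<Rightarrow>
     (nat \<Rightarrow> nat) \<Rightarrow> (nat \<Rightarrow> nat \<Rightarrow> real) \<Rightarrow> (nat \<Rightarrow> nat \<Rightarrow> 'a) \<Rightarrow>
     real \<Rightarrow> ('a \<Rightarrow> real) \<Rightarrow> ('a \<Rightarrow> real) \<Rightarrow> bool" where
  "mirror_descent_step \<Omega> n w m u x \<eta> \<rho> \<rho>' \<longleftrightarrow>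
     (\<exists>f. (\<forall>i\<in>{1..n}. kantorovich_potential \<Omega> \<rho> (m i) (u i) (x i) (f i)) \<and>
          (\<forall>y\<in>\<Omega>. \<rho>' y = \<rho> y * exp (- \<eta> * (\<Sum>i=1..n. w i * f i y)) /
             (LINT z:\<Omega>|lborel. \<rho> z * exp (- \<eta> * (\<Sum>i=1..n. w i * f i z)))))"

text \<open>\<open>T\<close> iterations started at \<open>\<rho>0\<close>, with any admissible choice of potentials in each iteration;
  \<open>\<nu> k\<close> and \<open>\<rho> k\<close> are the \<open>k\<close>-th iterate and its density, and are constrained only for \<open>k \<le> T\<close>.\<close>

definition mirror_descent_run ::
    "'a::euclidean_space set \<Rightarrow> nat \<Rightarrow> (nat \<Rightarrow> real) \<Rightarrow>
     (nat \<Rightarrow> nat) \<Rightarrow> (nat \<Rightarrow> nat \<Rightarrow> real) \<Rightarrow> (nat \<Rightarrow> nat \<Rightarrow> 'a) \<Rightarrow>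
     ('a \<Rightarrow> real) \<Rightarrow> (nat \<Rightarrow> real) \<Rightarrow> nat \<Rightarrow> (nat \<Rightarrow> 'a measure) \<Rightarrow> (nat \<Rightarrow> 'a \<Rightarrow> real) \<Rightarrow> bool" where
  "mirror_descent_run \<Omega> n w m u x \<rho>0 \<eta> T \<nu> \<rho> \<longleftrightarrow>
     (\<forall>y\<in>\<Omega>. \<rho> 0 y = \<rho>0 y) \<and>
     (\<forall>k\<le>T. has_density_on \<Omega> (\<nu> k) (\<rho> k)) \<and>
     (\<forall>k<T. mirror_descent_step \<Omega> n w m u x (\<eta> k) (\<rho> k) (\<rho> (Suc k)))"

end

theory Submission
  imports Defs
begin

text \<open>
  By semi-discrete duality, \<open>G\<^sub>k = \<Sum>\<^sub>i w\<^sub>i \<phi>\<^sub>i\<close> is a subgradient of the barycenter functional at the iterate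
  \<open>\<nu>\<^sub>k\<close>: \<open>\<E> \<nu>\<^sub>k - \<E> \<sigma> \<le> \<integral>G\<^sub>k d\<nu>\<^sub>k - \<integral>G\<^sub>k d\<sigma>\<close> for every probability measure \<open>\<sigma>\<close> on \<open>\<Omega>\<close>. Normalization makes \<open>G\<^sub>k\<close>
  bounded by \<open>D\<^sup>2\<close> and \<open>D\<close>-Lipschitz on \<open>\<Omega>\<close>, with \<open>D\<close> the diameter of \<open>\<Omega>\<close>. The iterates are exponential weights
  \<open>\<rho>\<^sub>T = \<rho>\<^sub>0 exp (- F) / \<Prod>\<^sub>k Z\<^sub>k\<close> with \<open>F = \<Sum>\<^sub>k \<eta>\<^sub>k G\<^sub>k\<close>, and \<open>ln Z\<^sub>k \<le> - \<eta>\<^sub>k \<integral>G\<^sub>k d\<nu>\<^sub>k + \<eta>\<^sub>k\<^sup>2 D\<^sup>4 / 2\<close>.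
  The minimizer \<open>\<sigma>\<close> may be singular, so its relative entropy is of no use; instead \<open>\<integral>F d\<sigma> \<ge> min F\<close>, and
  \<open>- \<Sum>\<^sub>k ln Z\<^sub>k\<close> exceeds \<open>min F\<close> by at most \<open>d ln T + O(1)\<close>, because \<open>F\<close> is within \<open>O(1)\<close> of its minimum
  on a copy of \<open>\<Omega>\<close> shrunk by the factor \<open>1 / T\<close> towards a minimizer.
\<close>

subsection \<open>The semi-discrete transform and discrete measures\<close>

lemma semidiscrete_transform_le:
  assumes "j \<in> {1..m}"
  shows "semidiscrete_transform m x \<phi> y \<le> (norm (y - x j))\<^sup>2 / 2 - \<phi> j"
  unfolding semidiscrete_transform_def using assms by (intro Min_le) auto

lemma semidiscrete_transform_attained:
  assumes "1 \<le> m"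
  obtains j where "j \<in> {1..m}" "semidiscrete_transform m x \<phi> y = (norm (y - x j))\<^sup>2 / 2 - \<phi> j"
proof -
  have "semidiscrete_transform m x \<phi> y \<in> (\<lambda>j. (norm (y - x j))\<^sup>2 / 2 - \<phi> j) ` {1..m}"
    unfolding semidiscrete_transform_def using assms by (intro Min_in) auto
  then show thesis using that by blast
qed

lemma semidiscrete_transform_measurable [measurable]:
  fixes x :: "nat \<Rightarrow> 'a::euclidean_space"
  shows "semidiscrete_transform m x \<phi> \<in> borel_measurable borel"
  unfolding semidiscrete_transform_def by (intro borel_measurable_Min) auto

text \<open>The minimum is one of its terms. The right-hand side is continuous in \<open>y\<close>
  and serves as an integrable dominating function for every probability measure on a compact
  set.\<close>

lemma semidiscrete_transform_abs_le:
  assumes "1 \<le> m"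
  shows "\<bar>semidiscrete_transform m x \<phi> y\<bar> \<le> (\<Sum>j=1..m. \<bar>(norm (y - x j))\<^sup>2 / 2 - \<phi> j\<bar>)"
proof -
  obtain j where "j \<in> {1..m}" "semidiscrete_transform m x \<phi> y = (norm (y - x j))\<^sup>2 / 2 - \<phi> j"
    using semidiscrete_transform_attained[OF assms] by blast
  then show ?thesis
    using member_le_sum[of j "{1..m}" "\<lambda>j. \<bar>(norm (y - x j))\<^sup>2 / 2 - \<phi> j\<bar>"] by auto
qed

text \<open>Each half squared distance to a point of \<Omega> is \<open>D\<close>-Lipschitz on
  \<Omega>, its gradient having norm at most \<open>D\<close> there, and a minimum of such functions
  shifted by constants inherits the constant.\<close>

lemma semidiscrete_transform_lipschitz_on:
  fixes x :: "nat \<Rightarrow> 'a::euclidean_space"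
  assumes m: "1 \<le> m" and x: "\<And>j. j \<in> {1..m} \<Longrightarrow> x j \<in> \<Omega>"
    and D: "\<And>y z. y \<in> \<Omega> \<Longrightarrow> z \<in> \<Omega> \<Longrightarrow> norm (y - z) \<le> D" and D0: "0 \<le> D"
  shows "D-lipschitz_on \<Omega> (semidiscrete_transform m x \<phi>)"
proof -
  let ?F = "semidiscrete_transform m x \<phi>"
  \<comment> \<open>The index minimal at \<open>z\<close> is a competitor at \<open>y\<close>; the
    difference of the two squares is then factored.\<close>
  have *: "?F y \<le> ?F z + D * norm (y - z)" if y: "y \<in> \<Omega>" and z: "z \<in> \<Omega>" for y z
  proof -
    obtain j where j: "j \<in> {1..m}" "?F z = (norm (z - x j))\<^sup>2 / 2 - \<phi> j"
      using semidiscrete_transform_attained[OF m] by blast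
    have "(norm (y - x j))\<^sup>2 - (norm (z - x j))\<^sup>2
        = (norm (y - x j) - norm (z - x j)) * (norm (y - x j) + norm (z - x j))"
      by (simp add: power2_eq_square algebra_simps)
    also have "\<dots> \<le> norm (y - z) * (norm (y - x j) + norm (z - x j))"
      using norm_triangle_ineq2[of "y - x j" "z - x j"] by (intro mult_right_mono) auto
    also have "\<dots> \<le> norm (y - z) * (D + D)"
      using D[OF y x[OF j(1)]] D[OF z x[OF j(1)]] by (intro mult_left_mono add_mono) auto
    finally show ?thesis
      using semidiscrete_transform_le[OF j(1), of x \<phi> y] j(2) by (simp add: algebra_simps)
  qed
  show ?thesis
  proof (rule lipschitz_onI[OF _ D0])
    fix y z assume "y \<in> \<Omega>" "z \<in> \<Omega>"
    then show "dist (?F y) (?F z) \<le> D * dist y z"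
      using *[of y z] *[of z y] by (simp add: dist_norm norm_minus_commute abs_le_iff)
  qed
qed

section \<open>Integrability with respect to probability measures on \<Omega>\<close>

lemma AE_in_support:
  assumes "\<nu> \<in> prob_measures_on \<Omega>" "\<Omega> \<in> sets borel"
  shows "AE y in \<nu>. y \<in> \<Omega>"
  using assms by (intro AE_I[where N = "- \<Omega>"]) (auto simp: prob_measures_on_def)

lemma borel_measurable_sets_eq:
  "sets \<nu> = sets borel \<Longrightarrow> g \<in> borel_measurable borel \<Longrightarrow> g \<in> borel_measurable \<nu>"
  using measurable_cong_sets by blast

lemma integrable_continuous_prob_on:
  fixes g :: "'a::euclidean_space \<Rightarrow> real"
  assumes \<nu>: "\<nu> \<in> prob_measures_on \<Omega>" and \<Omega>: "compact \<Omega>" and g: "continuous_on UNIV g"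
  shows "integrable \<nu> g"
proof -
  interpret prob_space \<nu> using \<nu> by (simp add: prob_measures_on_def)
  have sets: "sets \<nu> = sets borel" using \<nu> by (simp add: prob_measures_on_def)
  have "bounded (g ` \<Omega>)"
    using compact_continuous_image[OF continuous_on_subset[OF g] \<Omega>] compact_imp_bounded by auto
  then obtain B where B: "\<And>y. y \<in> \<Omega> \<Longrightarrow> norm (g y) \<le> B" by (auto simp: bounded_iff)
  have "g \<in> borel_measurable borel" by (rule borel_measurable_continuous_onI[OF g])
  then have "g \<in> borel_measurable \<nu>" by (rule borel_measurable_sets_eq[OF sets])
  then show ?thesis
    using AE_in_support[OF \<nu> borel_compact[OF \<Omega>]] B by (intro integrable_const_bound[of _ B]) auto
qed

lemma integrable_semidiscrete_transform:
  fixes x :: "nat \<Rightarrow> 'a::euclidean_space"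
  assumes \<nu>: "\<nu> \<in> prob_measures_on \<Omega>" and \<Omega>: "compact \<Omega>" and m: "1 \<le> m"
  shows "integrable \<nu> (semidiscrete_transform m x \<phi>)"
proof (rule Bochner_Integration.integrable_bound)
  show "integrable \<nu> (\<lambda>y. \<Sum>j=1..m. \<bar>(norm (y - x j))\<^sup>2 / 2 - \<phi> j\<bar>)"
    by (rule integrable_continuous_prob_on[OF \<nu> \<Omega>]) (intro continuous_intros, auto)
  have "sets \<nu> = sets borel" using \<nu> by (simp add: prob_measures_on_def)
  then show "semidiscrete_transform m x \<phi> \<in> borel_measurable \<nu>"
    by (rule borel_measurable_sets_eq) simp
  show "AE y in \<nu>. norm (semidiscrete_transform m x \<phi> y) \<le> norm (\<Sum>j=1..m. \<bar>(norm (y - x j))\<^sup>2 / 2 - \<phi> j\<bar>)"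
    using semidiscrete_transform_abs_le[OF m, of x \<phi>] by (intro AE_I2) (simp add: sum_nonneg)
qed

section \<open>Measures with a density on \<Omega>, and discrete measures\<close>

lemma
  fixes \<nu> :: "'a::euclidean_space measure"
  assumes "has_density_on \<Omega> \<nu> \<rho>"
  shows has_density_on_sets: "sets \<nu> = sets borel"
    and has_density_on_null: "N \<in> null_sets lborel \<Longrightarrow> N \<in> null_sets \<nu>"
    and has_density_on_integral: "g \<in> borel_measurable borel \<Longrightarrow>
          (\<integral>y. g y \<partial>\<nu>) = (LINT y:\<Omega>|lborel. g y * \<rho> y :: real)"
proof -
  have \<nu>: "\<nu> = density lborel (\<lambda>y. ennreal (indicator \<Omega> y * \<rho> y))"
    and \<rho>: "\<And>y. y \<in> \<Omega> \<Longrightarrow> 0 \<le> \<rho> y"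
    using assms by (auto simp: has_density_on_def)
  \<comment> \<open>Only the product of \<open>\<rho>\<close> with the indicator is known to be
    Borel; off \<Omega> the function \<open>\<rho>\<close> is unconstrained.\<close>
  have [measurable]: "(\<lambda>y. indicator \<Omega> y * \<rho> y) \<in> borel_measurable borel"
    using assms unfolding has_density_on_def set_borel_measurable_def real_scaleR_def by blast
  show s: "sets \<nu> = sets borel" by (simp add: \<nu>)
  show "N \<in> null_sets \<nu>" if "N \<in> null_sets lborel"
  proof -
    have "AE y in lborel. y \<notin> N" using that by (rule AE_not_in)
    moreover have "N \<in> sets lborel" using that by auto
    ultimately show ?thesis unfolding \<nu>
      by (subst null_sets_density_iff) (auto elim: eventually_mono)
  qed
  assume [measurable]: "g \<in> borel_measurable borel"
  show "(\<integral>y. g y \<partial>\<nu>) = (LINT y:\<Omega>|lborel. g y * \<rho> y)"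
    unfolding \<nu> set_lebesgue_integral_def
  proof (subst integral_density)
    show "AE y in lborel. 0 \<le> indicator \<Omega> y * \<rho> y" using \<rho> by (auto split: split_indicator)
  qed (auto intro!: Bochner_Integration.integral_cong)
qed

lemma has_density_on_prob_measures_on:
  fixes \<nu> :: "'a::euclidean_space measure"
  assumes d: "has_density_on \<Omega> \<nu> \<rho>" and "prob_space \<nu>" and [measurable]: "\<Omega> \<in> sets borel"
  shows "\<nu> \<in> prob_measures_on \<Omega>"
proof -
  have [measurable]: "(\<lambda>y. indicator \<Omega> y * \<rho> y) \<in> borel_measurable borel"
    using d by (auto simp: has_density_on_def set_borel_measurable_def)
  have "emeasure \<nu> (- \<Omega>) = (\<integral>\<^sup>+y. 0 \<partial>(lborel :: 'a measure))"
    using d unfolding has_density_on_def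
    by (simp add: emeasure_density) (auto intro!: nn_integral_zero' AE_I2 split: split_indicator)
  then show ?thesis
    using assms has_density_on_sets[OF d] by (simp add: prob_measures_on_def)
qed

lemma
  fixes x :: "nat \<Rightarrow> 'a::euclidean_space"
  assumes u: "\<And>j. j \<in> {1..m} \<Longrightarrow> 0 \<le> u j" and u1: "(\<Sum>j=1..m. u j) = 1"
  shows prob_space_discrete_measure: "prob_space (discrete_measure m u x)"
    and sets_discrete_measure: "sets (discrete_measure m u x) = sets borel"
    and AE_discrete_measure: "AE p in discrete_measure m u x. p \<in> x ` {1..m}"
    and integral_discrete_measure: "g \<in> borel_measurable borel \<Longrightarrow>
          (\<integral>p. g p \<partial>discrete_measure m u x) = (\<Sum>j=1..m. u j * g (x j) :: real)"
    and measure_discrete_measure: "A \<in> sets borel \<Longrightarrow>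
          measure (discrete_measure m u x) A = (\<Sum>j | j \<in> {1..m} \<and> x j \<in> A. u j)"
proof -
  \<comment> \<open>Atoms may coincide, so the mass of \<open>A\<close> is summed over indices and
    not over points.\<close>
  have e: "emeasure (discrete_measure m u x) A = ennreal (\<Sum>j | j \<in> {1..m} \<and> x j \<in> A. u j)"
    if "A \<in> sets borel" for A
  proof -
    have "emeasure (discrete_measure m u x) A =
        (\<Sum>j=1..m. ennreal (u j) * emeasure (return borel (x j)) A)"
      by (rule emeasure_discrete_measure[OF that])
    also have "\<dots> = (\<Sum>j=1..m. ennreal (if x j \<in> A then u j else 0))"
      using that by (intro sum.cong) (auto simp: indicator_def)
    also have "\<dots> = ennreal (\<Sum>j=1..m. if x j \<in> A then u j else 0)"
      using u by (intro sum_ennreal) auto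
    also have "(\<Sum>j=1..m. if x j \<in> A then u j else 0) = (\<Sum>j | j \<in> {1..m} \<and> x j \<in> A. u j)"
      by (subst sum.inter_filter [symmetric]) auto
    finally show ?thesis .
  qed
  show s: "sets (discrete_measure m u x) = sets borel" by (simp add: discrete_measure_def)
  show "prob_space (discrete_measure m u x)"
    using e[of UNIV] u1 sets_eq_imp_space_eq[OF s]
    by (intro prob_spaceI) (simp add: atLeastAtMost_def atLeast_def atMost_def Int_def)
  have "{j \<in> {1..m}. x j \<in> - (x ` {1..m})} = {}" by auto
  moreover have B: "- (x ` {1..m}) \<in> sets borel" by (intro borel_comp borel_closed finite_imp_closed) simp
  ultimately have "emeasure (discrete_measure m u x) (- (x ` {1..m})) = 0" using e[OF B] by (simp only: sum.empty ennreal_0)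
  with B show "AE p in discrete_measure m u x. p \<in> x ` {1..m}"
    using s by (intro AE_I[where N = "- (x ` {1..m})"]) auto
  show "measure (discrete_measure m u x) A = (\<Sum>j | j \<in> {1..m} \<and> x j \<in> A. u j)" if "A \<in> sets borel"
    unfolding measure_def e[OF that] using u by (intro enn2real_ennreal sum_nonneg) auto
  assume [measurable]: "g \<in> borel_measurable borel"
  show "(\<integral>p. g p \<partial>discrete_measure m u x) = (\<Sum>j=1..m. u j * g (x j))"
    unfolding discrete_measure_def using u
    by (subst integral_distr, simp, simp, subst lebesgue_integral_point_measure_finite) auto
qed

subsection \<open>Couplings and weak duality\<close>

lemma discrete_measure_prob_measures_on:
  fixes x :: "nat \<Rightarrow> 'a::euclidean_space"
  assumes u: "\<And>j. j \<in> {1..m} \<Longrightarrow> 0 \<le> u j" and u1: "(\<Sum>j=1..m. u j) = 1"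
    and x: "\<And>j. j \<in> {1..m} \<Longrightarrow> x j \<in> \<Omega>" and \<Omega>: "\<Omega> \<in> sets borel"
  shows "discrete_measure m u x \<in> prob_measures_on \<Omega>"
proof -
  have "emeasure (discrete_measure m u x) (- \<Omega>) = (\<Sum>j=1..m. 0)"
    using \<Omega> x by (subst emeasure_discrete_measure) (auto intro!: sum.neutral)
  then show ?thesis
    using prob_space_discrete_measure[OF u u1, of x] sets_discrete_measure[OF u u1, of x]
    by (simp add: prob_measures_on_def)
qed

lemma pair_measure_in_couplings:
  fixes \<mu> \<nu> :: "'a::euclidean_space measure"
  assumes "prob_space \<mu>" "sets \<mu> = sets borel" "prob_space \<nu>" "sets \<nu> = sets borel"
  shows "\<mu> \<Otimes>\<^sub>M \<nu> \<in> couplings \<mu> \<nu>"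
proof -
  interpret \<mu>: prob_space \<mu> by fact
  interpret \<nu>: prob_space \<nu> by fact
  interpret P: pair_prob_space \<mu> \<nu> ..
  interpret Q: pair_prob_space \<nu> \<mu> ..
  have "distr (\<mu> \<Otimes>\<^sub>M \<nu>) borel fst = distr (\<mu> \<Otimes>\<^sub>M \<nu>) \<mu> fst"
    using assms by (intro distr_cong) auto
  \<comment> \<open>The second marginal is the first marginal of the swapped product.\<close>
  moreover have "distr (\<mu> \<Otimes>\<^sub>M \<nu>) borel snd = distr (\<nu> \<Otimes>\<^sub>M \<mu>) \<nu> fst"
    by (subst Q.distr_pair_swap, subst distr_distr)
       (use assms in \<open>auto intro!: distr_cong simp: comp_def split_beta\<close>)
  moreover have "sets (\<mu> \<Otimes>\<^sub>M \<nu>) = sets borel"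
    using assms by (metis borel_prod sets_pair_measure_cong)
  ultimately show ?thesis
    using \<mu>.distr_pair_fst[of \<nu>] \<nu>.distr_pair_fst[of \<mu>] by (simp add: couplings_def)
qed

text \<open>Both coordinates lie in \<Omega> almost surely, so the cost is bounded by the squared
  diameter. This allows replacing the \<open>ennreal\<close> cost in \<open>W2_sq\<close> by an
  ordinary integral.\<close>

lemma
  fixes \<mu> \<nu> :: "'a::euclidean_space measure"
  assumes \<pi>: "\<pi> \<in> couplings \<mu> \<nu>" and \<mu>: "\<mu> \<in> prob_measures_on \<Omega>" and \<nu>: "\<nu> \<in> prob_measures_on \<Omega>"
    and \<Omega>: "compact \<Omega>"
  shows coupling_integrable: "integrable \<pi> (\<lambda>(x, y). (norm (x - y))\<^sup>2)" (is ?A)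
    and coupling_nn_integral:
      "(\<integral>\<^sup>+ (x, y). ennreal ((norm (x - y))\<^sup>2) \<partial>\<pi>) = ennreal (\<integral>(x, y). (norm (x - y))\<^sup>2 \<partial>\<pi>)"
proof -
  have s: "sets \<pi> = sets borel" and f: "distr \<pi> borel fst = \<mu>" and g: "distr \<pi> borel snd = \<nu>"
    using \<pi> by (auto simp: couplings_def)
  have [measurable]: "fst \<in> \<pi> \<rightarrow>\<^sub>M borel" "snd \<in> \<pi> \<rightarrow>\<^sub>M borel"
    unfolding measurable_cong_sets[OF s refl] by (auto intro!: borel_measurable_continuous_onI continuous_intros)
  \<comment> \<open>Membership in \<open>couplings\<close> does not mention total mass; it is
    inherited from the first marginal.\<close>
  interpret \<pi>: prob_space \<pi>
    using prob_space_distrD[of fst \<pi> borel] \<mu> f by (simp add: prob_measures_on_def)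
  have \<Omega>b: "\<Omega> \<in> sets borel" using \<Omega> by (rule borel_compact)
  have "AE z in \<pi>. fst z \<in> \<Omega>"
    using AE_in_support[OF \<mu> \<Omega>b] unfolding f[symmetric] by (rule AE_distrD[rotated]) simp
  moreover have "AE z in \<pi>. snd z \<in> \<Omega>"
    using AE_in_support[OF \<nu> \<Omega>b] unfolding g[symmetric] by (rule AE_distrD[rotated]) simp
  ultimately have "AE z in \<pi>. norm ((norm (fst z - snd z))\<^sup>2) \<le> (diameter \<Omega>)\<^sup>2"
  proof eventually_elim
    case (elim z)
    then show ?case
      using diameter_bounded_bound[OF compact_imp_bounded[OF \<Omega>], of "fst z" "snd z"]
      by (simp add: dist_norm power_mono)
  qed
  then have "integrable \<pi> (\<lambda>z. (norm (fst z - snd z))\<^sup>2)"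
    by (intro \<pi>.integrable_const_bound) measurable
  then show ?A by (simp add: split_beta')
  then show "(\<integral>\<^sup>+ (x, y). ennreal ((norm (x - y))\<^sup>2) \<partial>\<pi>) = ennreal (\<integral>(x, y). (norm (x - y))\<^sup>2 \<partial>\<pi>)"
    by (subst nn_integral_eq_integral[symmetric]) (auto simp: split_beta')
qed

lemma W2_sq_le:
  fixes \<mu> \<nu> :: "'a::euclidean_space measure"
  assumes "\<pi> \<in> couplings \<mu> \<nu>" "\<mu> \<in> prob_measures_on \<Omega>" "\<nu> \<in> prob_measures_on \<Omega>" "compact \<Omega>"
  shows "W2_sq \<mu> \<nu> \<le> (\<integral>(x, y). (norm (x - y))\<^sup>2 \<partial>\<pi>)"
proof -
  have "(INF \<pi>\<in>couplings \<mu> \<nu>. \<integral>\<^sup>+ (x, y). ennreal ((norm (x - y))\<^sup>2) \<partial>\<pi>)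
      \<le> ennreal (\<integral>(x, y). (norm (x - y))\<^sup>2 \<partial>\<pi>)"
    unfolding coupling_nn_integral[OF assms, symmetric] by (intro INF_lower assms)
  then show ?thesis unfolding W2_sq_def
    by (intro enn2real_leI) (auto intro!: Bochner_Integration.integral_nonneg)
qed

lemma W2_sq_ge:
  fixes \<mu> \<nu> :: "'a::euclidean_space measure"
  assumes m: "\<mu> \<in> prob_measures_on \<Omega>" "\<nu> \<in> prob_measures_on \<Omega>" "compact \<Omega>"
    and c: "\<And>\<pi>. \<pi> \<in> couplings \<mu> \<nu> \<Longrightarrow> c \<le> (\<integral>(x, y). (norm (x - y))\<^sup>2 \<partial>\<pi>)"
  shows "c \<le> W2_sq \<mu> \<nu>"
proof -
  let ?I = "INF \<pi>\<in>couplings \<mu> \<nu>. \<integral>\<^sup>+ (x, y). ennreal ((norm (x - y))\<^sup>2) \<partial>\<pi>"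
  \<comment> \<open>\<open>enn2real\<close> sends infinity to 0, so a lower bound survives it only
    if the infimum is finite; the product coupling shows that it is.\<close>
  have P: "\<mu> \<Otimes>\<^sub>M \<nu> \<in> couplings \<mu> \<nu>"
    using m by (intro pair_measure_in_couplings) (auto simp: prob_measures_on_def)
  have "?I \<le> (\<integral>\<^sup>+ (x, y). ennreal ((norm (x - y))\<^sup>2) \<partial>(\<mu> \<Otimes>\<^sub>M \<nu>))" by (rule INF_lower[OF P])
  also have "\<dots> < \<top>" using coupling_nn_integral[OF P m] by simp
  finally have fin: "?I < \<top>" .
  have "ennreal c \<le> ?I"
    using c coupling_nn_integral[OF _ m] by (intro INF_greatest) (simp add: ennreal_leI)
  with fin have "enn2real (ennreal c) \<le> enn2real ?I" by (intro enn2real_mono)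
  \<comment> \<open>For negative \<open>c\<close> the number \<open>ennreal c\<close> is 0, and the
    claim holds because \<open>W2_sq\<close> is nonnegative.\<close>
  then show ?thesis unfolding W2_sq_def
    by (cases "0 \<le> c") (auto intro: order_trans[of c 0])
qed

text \<open>The discrete potential as a function of the atom instead of its index. Atoms may coincide, and
  then only the largest value of \<open>\<phi>\<close> at an atom is relevant; \<open>Min\<close> is a harmless default.\<close>

definition atom_potential :: "nat \<Rightarrow> (nat \<Rightarrow> 'a) \<Rightarrow> (nat \<Rightarrow> real) \<Rightarrow> 'a::euclidean_space \<Rightarrow> real" where
  "atom_potential m x \<phi> p = (MAX j\<in>{1..m}. if x j = p then \<phi> j else Min (\<phi> ` {1..m}))"

lemma atom_potential_measurable [measurable]: "atom_potential m x \<phi> \<in> borel_measurable borel"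
  unfolding atom_potential_def by (intro borel_measurable_Max) auto

lemma atom_potential_ge: "j \<in> {1..m} \<Longrightarrow> \<phi> j \<le> atom_potential m x \<phi> (x j)"
  unfolding atom_potential_def by (intro Max_ge) (auto intro!: image_eqI[of _ _ j])

text \<open>This is admissibility of the pair of dual potentials. Indices sharing the atom
  \<open>x j\<close> all satisfy the inequality of the transform with the same distance, and the
  default value is at most \<open>\<phi> j\<close>.\<close>

lemma atom_potential_add_le:
  assumes j: "j \<in> {1..m}"
  shows "semidiscrete_transform m x \<phi> y + atom_potential m x \<phi> (x j) \<le> (norm (y - x j))\<^sup>2 / 2"
proof -
  have "(if x k = x j then \<phi> k else Min (\<phi> ` {1..m})) \<le> (norm (y - x j))\<^sup>2 / 2 - semidiscrete_transform m x \<phi> y"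
    if k: "k \<in> {1..m}" for k
  proof -
    have "Min (\<phi> ` {1..m}) \<le> \<phi> j" using j by (intro Min_le) auto
    then show ?thesis
      using semidiscrete_transform_le[OF k, of x \<phi> y] semidiscrete_transform_le[OF j, of x \<phi> y] by auto
  qed
  then have "\<forall>v \<in> (\<lambda>k. if x k = x j then \<phi> k else Min (\<phi> ` {1..m})) ` {1..m}.
      v \<le> (norm (y - x j))\<^sup>2 / 2 - semidiscrete_transform m x \<phi> y" by blast
  then have "atom_potential m x \<phi> (x j) \<le> (norm (y - x j))\<^sup>2 / 2 - semidiscrete_transform m x \<phi> y"
    unfolding atom_potential_def using j by (subst Max_le_iff) blast+
  then show ?thesis by simp
qed

text \<open>Integrating the admissibility inequality against any coupling bounds its cost from
  below. No density of \<nu> enters, so the bound also applies to a singular minimizer.\<close>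

lemma weak_duality_W2_sq:
  fixes x :: "nat \<Rightarrow> 'a::euclidean_space"
  assumes u: "\<And>j. j \<in> {1..m} \<Longrightarrow> 0 \<le> u j" and u1: "(\<Sum>j=1..m. u j) = 1"
    and x: "\<And>j. j \<in> {1..m} \<Longrightarrow> x j \<in> \<Omega>" and \<Omega>: "compact \<Omega>" and \<nu>: "\<nu> \<in> prob_measures_on \<Omega>"
  shows "(\<Sum>j=1..m. u j * \<phi> j) + (\<integral>y. semidiscrete_transform m x \<phi> y \<partial>\<nu>)
      \<le> W2_sq (discrete_measure m u x) \<nu> / 2"
proof -
  let ?\<mu> = "discrete_measure m u x" and ?F = "semidiscrete_transform m x \<phi>"
    and ?g = "atom_potential m x \<phi>"
  have m: "1 \<le> m" using u1 by (cases m) auto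
  have \<mu>: "?\<mu> \<in> prob_measures_on \<Omega>"
    using discrete_measure_prob_measures_on[OF u u1 x borel_compact[OF \<Omega>]] .
  have "2 * ((\<Sum>j=1..m. u j * \<phi> j) + (\<integral>y. ?F y \<partial>\<nu>)) \<le> W2_sq ?\<mu> \<nu>"
  proof (rule W2_sq_ge[OF \<mu> \<nu> \<Omega>])
    fix \<pi> assume \<pi>: "\<pi> \<in> couplings ?\<mu> \<nu>"
    have s: "sets \<pi> = sets borel" and f: "distr \<pi> borel fst = ?\<mu>" and g: "distr \<pi> borel snd = \<nu>"
      using \<pi> by (auto simp: couplings_def)
    have [measurable]: "fst \<in> \<pi> \<rightarrow>\<^sub>M borel" "snd \<in> \<pi> \<rightarrow>\<^sub>M borel"
      unfolding measurable_cong_sets[OF s refl] by (auto intro!: borel_measurable_continuous_onI continuous_intros)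
    interpret M: prob_space ?\<mu> using \<mu> by (simp add: prob_measures_on_def)
    have AEx: "AE p in ?\<mu>. p \<in> x ` {1..m}" by (rule AE_discrete_measure[OF u u1])
    have ig: "integrable ?\<mu> ?g"
    proof (rule M.integrable_const_bound)
      show "AE p in ?\<mu>. norm (?g p) \<le> (\<Sum>j=1..m. \<bar>?g (x j)\<bar>)"
        using AEx by eventually_elim
          (use member_le_sum[of _ "{1..m}" "\<lambda>j. \<bar>?g (x j)\<bar>"] in auto)
      show "?g \<in> borel_measurable ?\<mu>"
        by (rule borel_measurable_sets_eq[OF sets_discrete_measure[OF u u1] atom_potential_measurable])
    qed
    have ig': "integrable \<pi> (\<lambda>z. ?g (fst z))"
      using ig unfolding f[symmetric] by (rule integrable_distr[rotated]) simp
    have iF': "integrable \<pi> (\<lambda>z. ?F (snd z))"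
      using integrable_semidiscrete_transform[OF \<nu> \<Omega> m] unfolding g[symmetric]
      by (rule integrable_distr[rotated]) simp
    \<comment> \<open>\<open>?g\<close> dominates \<open>\<phi>\<close> at the atoms and depends on
      the point alone, so its weighted sum is an integral against the first marginal.\<close>
    have "(\<Sum>j=1..m. u j * \<phi> j) + (\<integral>y. ?F y \<partial>\<nu>) \<le> (\<Sum>j=1..m. u j * ?g (x j)) + (\<integral>y. ?F y \<partial>\<nu>)"
      using u atom_potential_ge[of _ m \<phi> x] by (intro add_mono sum_mono mult_left_mono) auto
    also have "\<dots> = (\<integral>p. ?g p \<partial>?\<mu>) + (\<integral>y. ?F y \<partial>\<nu>)"
      by (subst integral_discrete_measure[OF u u1 atom_potential_measurable]) auto
    also have "\<dots> = (\<integral>z. ?g (fst z) \<partial>\<pi>) + (\<integral>z. ?F (snd z) \<partial>\<pi>)"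
      by (subst f[symmetric], subst g[symmetric]) (simp add: integral_distr)
    also have "\<dots> = (\<integral>z. ?g (fst z) + ?F (snd z) \<partial>\<pi>)"
      using ig' iF' by simp
    also have "\<dots> \<le> (\<integral>z. (case z of (x, y) \<Rightarrow> (norm (x - y))\<^sup>2) / 2 \<partial>\<pi>)"
    proof (rule integral_mono_AE)
      have "AE z in \<pi>. fst z \<in> x ` {1..m}"
        using AEx unfolding f[symmetric] by (rule AE_distrD[rotated]) simp
      then show "AE z in \<pi>. ?g (fst z) + ?F (snd z) \<le> (case z of (x, y) \<Rightarrow> (norm (x - y))\<^sup>2) / 2"
      proof eventually_elim
        case (elim z)
        then obtain j where j: "j \<in> {1..m}" "fst z = x j" by blast
        then show ?case using atom_potential_add_le[OF j(1), of x \<phi> "snd z"]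
          by (simp add: split_beta norm_minus_commute add.commute)
      qed
    qed (use ig' iF' coupling_integrable[OF \<pi> \<mu> \<nu> \<Omega>] in auto)
    finally show "2 * ((\<Sum>j=1..m. u j * \<phi> j) + (\<integral>y. ?F y \<partial>\<nu>)) \<le> (\<integral>(x, y). (norm (x - y))\<^sup>2 \<partial>\<pi>)"
      by simp
  qed
  then show ?thesis by simp
qed

subsection \<open>Strong duality\<close>

lemma semidiscrete_dual_eq:
  fixes x :: "nat \<Rightarrow> 'a::euclidean_space"
  assumes "has_density_on \<Omega> \<nu> \<rho>"
  shows "semidiscrete_dual \<Omega> \<rho> m u x \<phi>
    = (\<Sum>j=1..m. u j * \<phi> j) + (\<integral>y. semidiscrete_transform m x \<phi> y \<partial>\<nu>)"
  unfolding semidiscrete_dual_def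
  by (subst has_density_on_integral[OF assms semidiscrete_transform_measurable]) simp

text \<open>Raising \<open>\<phi>\<close> by \<open>t\<close> on \<open>S\<close> gains \<open>t * sum u S\<close> in the dual functional and loses at most \<open>t\<close>
  times the mass of the points where an index of \<open>S\<close> is minimal up to \<open>t\<close>; then \<open>t \<rightarrow> 0\<close>.\<close>

lemma weight_le_measure_argmin:
  fixes x :: "nat \<Rightarrow> 'a::euclidean_space"
  assumes d: "has_density_on \<Omega> \<nu> \<rho>" and \<nu>: "\<nu> \<in> prob_measures_on \<Omega>" and \<Omega>: "compact \<Omega>"
    and m: "1 \<le> m" and S: "S \<subseteq> {1..m}"
    and opt: "\<And>\<psi>. semidiscrete_dual \<Omega> \<rho> m u x \<psi> \<le> semidiscrete_dual \<Omega> \<rho> m u x \<phi>"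
  shows "sum u S \<le> measure \<nu> {y. \<exists>j\<in>S. semidiscrete_transform m x \<phi> y = (norm (y - x j))\<^sup>2 / 2 - \<phi> j}"
proof -
  let ?F = "semidiscrete_transform m x"
  define A where "A t = {y. \<exists>j\<in>S. (norm (y - x j))\<^sup>2 / 2 - \<phi> j < ?F \<phi> y + t}" for t
  interpret prob_space \<nu> using \<nu> by (simp add: prob_measures_on_def)
  have sets: "sets \<nu> = sets borel" using \<nu> by (simp add: prob_measures_on_def)
  have finS: "finite S" using S finite_subset by blast
  have A_borel: "A t \<in> sets borel" for t
  proof -
    have "A t = (\<Union>j\<in>S. {y. (norm (y - x j))\<^sup>2 / 2 - \<phi> j < ?F \<phi> y + t})" by (auto simp: A_def)
    then show ?thesis using finS by auto
  qed
  then have A_sets: "A t \<in> sets \<nu>" for t by (simp add: sets)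
  have le: "sum u S \<le> measure \<nu> (A t)" if t: "0 < t" for t
  proof -
    define \<psi> where "\<psi> j = \<phi> j + (if j \<in> S then t else 0)" for j
    \<comment> \<open>Off \<open>A t\<close> every index of \<open>S\<close> is at least
      \<open>t\<close> above the minimum, so lowering its term by \<open>t\<close> does not push it
      below the old minimum; on \<open>A t\<close> the minimum drops by at most
      \<open>t\<close>.\<close>
    have F: "?F \<phi> y - t * indicator (A t) y \<le> ?F \<psi> y" for y
    proof -
      obtain j where j: "j \<in> {1..m}" "?F \<psi> y = (norm (y - x j))\<^sup>2 / 2 - \<psi> j"
        using semidiscrete_transform_attained[OF m] by blast
      then show ?thesis
        using semidiscrete_transform_le[OF j(1), of x \<phi> y] t
        by (auto simp: \<psi>_def A_def indicator_def split: if_splits)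
    qed
    have "(\<Sum>j=1..m. u j * \<psi> j) = (\<Sum>j=1..m. u j * \<phi> j) + (\<Sum>j=1..m. if j \<in> S then u j * t else 0)"
      unfolding sum.distrib[symmetric] by (intro sum.cong) (auto simp: \<psi>_def algebra_simps)
    also have "(\<Sum>j=1..m. if j \<in> S then u j * t else 0) = t * sum u S"
      using S by (subst sum.inter_restrict[symmetric]) (auto simp: Int_absorb1 sum_distrib_left mult.commute)
    finally have s: "(\<Sum>j=1..m. u j * \<psi> j) = (\<Sum>j=1..m. u j * \<phi> j) + t * sum u S" .
    have i: "integrable \<nu> (?F \<phi>)" "integrable \<nu> (?F \<psi>)"
      by (rule integrable_semidiscrete_transform[OF \<nu> \<Omega> m])+
    have "(\<integral>y. ?F \<phi> y \<partial>\<nu>) - t * measure \<nu> (A t) = (\<integral>y. ?F \<phi> y - t * indicator (A t) y \<partial>\<nu>)"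
      using i A_sets[of t] by (subst Bochner_Integration.integral_diff) (auto simp: emeasure_eq_measure)
    also have "\<dots> \<le> (\<integral>y. ?F \<psi> y \<partial>\<nu>)"
      using i F A_sets[of t] by (intro integral_mono) (auto simp: emeasure_eq_measure)
    finally have "t * sum u S \<le> t * measure \<nu> (A t)"
      using opt[of \<psi>] s unfolding semidiscrete_dual_eq[OF d] by simp
    then show ?thesis using t by simp
  qed
  \<comment> \<open>Continuity from above along \<open>t = 1 / (n + 1)\<close>; the intersection
    turns out to be the set where an index of \<open>S\<close> is exactly minimal.\<close>
  have "(\<lambda>n. measure \<nu> (A (1 / real (Suc n)))) \<longlonglongrightarrow> measure \<nu> (\<Inter>n. A (1 / real (Suc n)))"
  proof (rule Lim_measure_decseq)
    have mono: "A s \<subseteq> A t" if "s \<le> t" for s t using that by (force simp: A_def)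
    show "decseq (\<lambda>n. A (1 / real (Suc n)))"
      by (intro decseq_SucI mono) (simp add: frac_le)
  qed (use A_sets in \<open>auto simp: emeasure_eq_measure\<close>)
  then have "sum u S \<le> measure \<nu> (\<Inter>n. A (1 / real (Suc n)))"
    by (rule LIMSEQ_le_const) (auto intro!: le)
  also have "(\<Inter>n. A (1 / real (Suc n))) = {y. \<exists>j\<in>S. ?F \<phi> y = (norm (y - x j))\<^sup>2 / 2 - \<phi> j}"
  proof (intro equalityI subsetI)
    fix y assume y: "y \<in> (\<Inter>n. A (1 / real (Suc n)))"
    show "y \<in> {y. \<exists>j\<in>S. ?F \<phi> y = (norm (y - x j))\<^sup>2 / 2 - \<phi> j}"
    proof (rule ccontr)
      assume "\<not> ?thesis"
      then have pos: "0 < (norm (y - x j))\<^sup>2 / 2 - \<phi> j - ?F \<phi> y" if "j \<in> S" for j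
        using semidiscrete_transform_le[of j m x \<phi> y] S that by fastforce
      have "S \<noteq> {}" using y by (auto simp: A_def)
      let ?D = "(\<lambda>j. (norm (y - x j))\<^sup>2 / 2 - \<phi> j - ?F \<phi> y) ` S"
      \<comment> \<open>\<open>S\<close> is finite, so if none of its indices is minimal at
        \<open>y\<close>, their excesses have a positive minimum, and \<open>y\<close> leaves
        \<open>A t\<close> for small \<open>t\<close>.\<close>
      have "0 < Min ?D" using pos finS \<open>S \<noteq> {}\<close> by (subst Min_gr_iff) auto
      then obtain n where n: "1 / real (Suc n) < Min ?D"
        using reals_Archimedean[of "Min ?D"] by (auto simp: inverse_eq_divide)
      obtain j where j: "j \<in> S" "(norm (y - x j))\<^sup>2 / 2 - \<phi> j < ?F \<phi> y + 1 / real (Suc n)"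
        using y by (auto simp: A_def)
      have "Min ?D \<le> (norm (y - x j))\<^sup>2 / 2 - \<phi> j - ?F \<phi> y" using finS j(1) by (intro Min_le) auto
      then show False using n j(2) by linarith
    qed
  next
    fix y assume "y \<in> {y. \<exists>j\<in>S. ?F \<phi> y = (norm (y - x j))\<^sup>2 / 2 - \<phi> j}"
    then obtain j where "j \<in> S" "?F \<phi> y = (norm (y - x j))\<^sup>2 / 2 - \<phi> j" by blast
    then have "y \<in> A t" if "0 < t" for t using that unfolding A_def by force
    then show "y \<in> (\<Inter>n. A (1 / real (Suc n)))" by simp
  qed
  finally show ?thesis .
qed

text \<open>The terms quadratic in \<open>y\<close> cancel, leaving a hyperplane with the nonzero
  normal \<open>q - p\<close>.\<close>

lemma null_sets_tie:
  fixes p q :: "'a::euclidean_space"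
  assumes "p \<noteq> q"
  shows "{y. (norm (y - p))\<^sup>2 / 2 - s = (norm (y - q))\<^sup>2 / 2 - t} \<in> null_sets lborel" (is "?N \<in> _")
proof -
  have "(norm (y - c))\<^sup>2 = y \<bullet> y - 2 * (c \<bullet> y) + c \<bullet> c" for y c :: 'a
    by (simp add: power2_norm_eq_inner inner_diff_left inner_diff_right inner_commute[of y c])
  then have "?N = {y. (q - p) \<bullet> y = (q \<bullet> q - p \<bullet> p) / 2 + s - t}"
    by (auto simp: inner_diff_left diff_divide_distrib add_divide_distrib)
  then have "negligible ?N" using assms negligible_hyperplane[of "q - p"] by auto
  moreover have "?N \<in> sets borel" by measurable
  ultimately show ?thesis
    using null_sets_completion_iff[of ?N lborel] by (simp add: negligible_iff_null_sets)
qed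

text \<open>Sending \<open>y\<close> to the atom of a minimal index is an optimal transport map:
  optimality of \<open>\<phi>\<close> forces it to push \<nu> forward to the discrete measure, and
  the cost along its graph is bounded by the dual value.\<close>

lemma strong_duality_W2_sq:
  fixes x :: "nat \<Rightarrow> 'a::euclidean_space"
  assumes d: "has_density_on \<Omega> \<nu> \<rho>" and \<nu>: "\<nu> \<in> prob_measures_on \<Omega>" and \<Omega>: "compact \<Omega>"
    and u: "\<And>j. j \<in> {1..m} \<Longrightarrow> 0 \<le> u j" and u1: "(\<Sum>j=1..m. u j) = 1"
    and x: "\<And>j. j \<in> {1..m} \<Longrightarrow> x j \<in> \<Omega>"
    and opt: "\<And>\<psi>. semidiscrete_dual \<Omega> \<rho> m u x \<psi> \<le> semidiscrete_dual \<Omega> \<rho> m u x \<phi>"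
  shows "W2_sq (discrete_measure m u x) \<nu> / 2
      \<le> (\<Sum>j=1..m. u j * \<phi> j) + (\<integral>y. semidiscrete_transform m x \<phi> y \<partial>\<nu>)"
proof -
  let ?\<mu> = "discrete_measure m u x" and ?F = "semidiscrete_transform m x \<phi>"
    and ?g = "atom_potential m x \<phi>"
  have m: "1 \<le> m" using u1 by (cases m) auto
  have \<mu>: "?\<mu> \<in> prob_measures_on \<Omega>"
    using discrete_measure_prob_measures_on[OF u u1 x borel_compact[OF \<Omega>]] .
  interpret prob_space \<nu> using \<nu> by (simp add: prob_measures_on_def)
  interpret M: prob_space ?\<mu> using \<mu> by (simp add: prob_measures_on_def)
  have sets: "sets \<nu> = sets borel" using \<nu> by (simp add: prob_measures_on_def)
  have sets\<mu>: "sets ?\<mu> = sets borel" using \<mu> by (simp add: prob_measures_on_def)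
  \<comment> \<open>Taking the least minimal index breaks ties measurably.\<close>
  define J where "J y = (LEAST j. j \<in> {1..m} \<and> ?F y = (norm (y - x j))\<^sup>2 / 2 - \<phi> j)" for y
  have J: "J y \<in> {1..m}" "?F y = (norm (y - x (J y)))\<^sup>2 / 2 - \<phi> (J y)" for y
  proof -
    obtain j where "j \<in> {1..m} \<and> ?F y = (norm (y - x j))\<^sup>2 / 2 - \<phi> j"
      using semidiscrete_transform_attained[OF m] by blast
    then have "J y \<in> {1..m} \<and> ?F y = (norm (y - x (J y)))\<^sup>2 / 2 - \<phi> (J y)"
      unfolding J_def by (rule LeastI)
    then show "J y \<in> {1..m}" "?F y = (norm (y - x (J y)))\<^sup>2 / 2 - \<phi> (J y)" by auto
  qed
  define T where "T y = x (J y)" for y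
  have "J \<in> borel \<rightarrow>\<^sub>M count_space UNIV" unfolding J_def by measurable
  then have T_borel [measurable]: "T \<in> borel_measurable borel"
    unfolding T_def by (rule measurable_compose) simp
  then have T: "T \<in> borel_measurable \<nu>" by (rule borel_measurable_sets_eq[OF sets])
  have le: "measure ?\<mu> B \<le> measure \<nu> (T -` B)" if B: "B \<in> sets borel" for B
  proof -
    let ?S = "{j \<in> {1..m}. x j \<in> B}"
    \<comment> \<open>Ties matter only between distinct atoms: indices with the same atom may tie on
      a set of positive measure, but \<open>T\<close> does not distinguish them.\<close>
    let ?N = "\<Union>(j, k)\<in>{(j, k). j \<in> {1..m} \<and> k \<in> {1..m} \<and> x j \<noteq> x k}.
        {y. (norm (y - x j))\<^sup>2 / 2 - \<phi> j = (norm (y - x k))\<^sup>2 / 2 - \<phi> k}"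
    have "finite {(j, k). j \<in> {1..m} \<and> k \<in> {1..m} \<and> x j \<noteq> x k}"
      by (rule finite_subset[of _ "{1..m} \<times> {1..m}"]) auto
    then have "?N \<in> null_sets lborel"
      by (intro null_sets_UN' countable_finite) (auto intro!: null_sets_tie)
    then have N: "?N \<in> null_sets \<nu>" by (rule has_density_on_null[OF d])
    have TB: "T -` B \<in> sets \<nu>" using B measurable_sets[OF T_borel, of B] by (simp add: sets)
    have "measure ?\<mu> B = sum u ?S" by (rule measure_discrete_measure[OF u u1 B])
    also have "\<dots> \<le> measure \<nu> {y. \<exists>j\<in>?S. ?F y = (norm (y - x j))\<^sup>2 / 2 - \<phi> j}"
      by (rule weight_le_measure_argmin[OF d \<nu> \<Omega> m _ opt]) auto
    also have "\<dots> \<le> measure \<nu> (T -` B \<union> ?N)"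
    proof (rule finite_measure_mono)
      show "{y. \<exists>j\<in>?S. ?F y = (norm (y - x j))\<^sup>2 / 2 - \<phi> j} \<subseteq> T -` B \<union> ?N"
      proof (intro subsetI)
        fix y assume "y \<in> {y. \<exists>j\<in>?S. ?F y = (norm (y - x j))\<^sup>2 / 2 - \<phi> j}"
        then obtain j where j: "j \<in> {1..m}" "x j \<in> B" "?F y = (norm (y - x j))\<^sup>2 / 2 - \<phi> j" by blast
        show "y \<in> T -` B \<union> ?N"
        proof (cases "x (J y) = x j")
          case True
          then show ?thesis using j by (simp add: T_def)
        next
          case False
          have "(norm (y - x (J y)))\<^sup>2 / 2 - \<phi> (J y) = (norm (y - x j))\<^sup>2 / 2 - \<phi> j"
            using j(3) J(2)[of y] by simp
          then show ?thesis using J(1)[of y] j(1) False by blast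
        qed
      qed
      show "T -` B \<union> ?N \<in> sets \<nu>" using TB N by auto
    qed
    also have "\<dots> = measure \<nu> (T -` B)" by (rule measure_Un_null_set[OF TB N])
    finally show ?thesis .
  qed
  have distr: "distr \<nu> borel T = ?\<mu>"
  proof (rule measure_eqI)
    fix B assume "B \<in> sets (distr \<nu> borel T)"
    then have B: "B \<in> sets borel" by simp
    have TB: "T -` B \<in> events" using B measurable_sets[OF T_borel, of B] by (simp add: sets)
    have sp: "space \<nu> = UNIV" "space ?\<mu> = UNIV" using sets_eq_imp_space_eq[OF sets] sets_eq_imp_space_eq[OF sets\<mu>] by simp_all
    \<comment> \<open>The one-sided bound, applied to the complement, gives the reverse inequality,
      since both measures have mass one.\<close>
    have "1 - measure ?\<mu> B = measure ?\<mu> (- B)"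
      using B sets\<mu> sp M.prob_compl[of B] by (simp add: Compl_eq_Diff_UNIV)
    also have "\<dots> \<le> measure \<nu> (T -` (- B))" using B by (intro le) auto
    also have "\<dots> = 1 - measure \<nu> (T -` B)"
      using TB sp prob_compl[of "T -` B"] by (simp add: Compl_eq_Diff_UNIV vimage_Diff)
    finally have "measure ?\<mu> B = measure \<nu> (T -` B)" using le[OF B] by simp
    then show "emeasure (distr \<nu> borel T) B = emeasure ?\<mu> B"
      using B T sp by (simp add: emeasure_distr emeasure_eq_measure M.emeasure_eq_measure)
  qed (simp add: sets\<mu>)
  let ?\<pi> = "distr \<nu> borel (\<lambda>y. (T y, y))"
  have id: "(\<lambda>y. y) \<in> borel_measurable \<nu>" by (rule borel_measurable_sets_eq[OF sets]) simp
  have pair: "(\<lambda>y. (T y, y)) \<in> \<nu> \<rightarrow>\<^sub>M borel"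
    using measurable_Pair[OF T id] by (simp add: borel_prod)
  have fst_snd: "(fst :: 'a \<times> 'a \<Rightarrow> 'a) \<in> borel \<rightarrow>\<^sub>M borel" "(snd :: 'a \<times> 'a \<Rightarrow> 'a) \<in> borel \<rightarrow>\<^sub>M borel"
    by (auto intro!: borel_measurable_continuous_onI continuous_intros)
  have \<pi>: "?\<pi> \<in> couplings ?\<mu> \<nu>"
  proof -
    have "distr \<nu> borel (\<lambda>y. y) = \<nu>"
      by (rule distr_id2) (rule sets[symmetric])
    then show ?thesis
      using distr by (simp add: couplings_def distr_distr[OF fst_snd(1) pair]
          distr_distr[OF fst_snd(2) pair] comp_def)
  qed
  have iF: "integrable \<nu> ?F" by (rule integrable_semidiscrete_transform[OF \<nu> \<Omega> m])
  have ig: "integrable \<nu> (\<lambda>y. ?g (T y))"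
  proof (rule integrable_const_bound)
    show "AE y in \<nu>. norm (?g (T y)) \<le> (\<Sum>j=1..m. \<bar>?g (x j)\<bar>)"
      using member_le_sum[of "J _" "{1..m}" "\<lambda>j. \<bar>?g (x j)\<bar>"] J(1) by (intro AE_I2) (simp add: T_def)
    show "(\<lambda>y. ?g (T y)) \<in> borel_measurable \<nu>" by (rule measurable_compose[OF T]) simp
  qed
  have cost: "(\<lambda>(x, y). (norm (x - y))\<^sup>2) \<in> borel_measurable (borel :: ('a \<times> 'a) measure)"
    unfolding split_beta' by (auto intro!: borel_measurable_continuous_onI continuous_intros)
  have "W2_sq ?\<mu> \<nu> / 2 \<le> (\<integral>(x, y). (norm (x - y))\<^sup>2 \<partial>?\<pi>) / 2"
    using W2_sq_le[OF \<pi> \<mu> \<nu> \<Omega>] by simp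
  also have "\<dots> = (\<integral>y. (norm (T y - y))\<^sup>2 / 2 \<partial>\<nu>)"
    by (subst integral_distr[OF pair cost]) simp
  also have "\<dots> \<le> (\<integral>y. ?g (T y) + ?F y \<partial>\<nu>)"
  proof (rule integral_mono)
    show "integrable \<nu> (\<lambda>y. (norm (T y - y))\<^sup>2 / 2)"
      using integrable_distr[OF pair coupling_integrable[OF \<pi> \<mu> \<nu> \<Omega>]] by simp
    fix y
    show "(norm (T y - y))\<^sup>2 / 2 \<le> ?g (T y) + ?F y"
      using atom_potential_ge[OF J(1)[of y], of \<phi> x] J(2)[of y] by (simp add: T_def norm_minus_commute)
  qed (use ig iF in simp)
  also have "\<dots> = (\<integral>p. ?g p \<partial>?\<mu>) + (\<integral>y. ?F y \<partial>\<nu>)"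
    unfolding Bochner_Integration.integral_add[OF ig iF]
      distr[symmetric] integral_distr[OF T atom_potential_measurable] ..
  also have "(\<integral>p. ?g p \<partial>?\<mu>) = (\<Sum>j=1..m. u j * ?g (x j))"
    by (rule integral_discrete_measure[OF u u1 atom_potential_measurable])
  also have "\<dots> \<le> (\<Sum>j=1..m. u j * \<phi> j)"
  proof -
    \<comment> \<open>If atoms coincide, \<open>?g\<close> may exceed \<open>\<phi>\<close>. Passing
      to \<open>?g\<close> does not decrease the transform, so by optimality of
      \<open>\<phi>\<close> it cannot increase the weighted sum.\<close>
    let ?G = "semidiscrete_transform m x (\<lambda>j. ?g (x j))"
    have "(\<integral>y. ?F y \<partial>\<nu>) \<le> (\<integral>y. ?G y \<partial>\<nu>)"
    proof (rule integral_mono[OF iF integrable_semidiscrete_transform[OF \<nu> \<Omega> m]])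
      fix y
      obtain j where j: "j \<in> {1..m}" "?G y = (norm (y - x j))\<^sup>2 / 2 - ?g (x j)"
        using semidiscrete_transform_attained[OF m] by blast
      then show "?F y \<le> ?G y" using atom_potential_add_le[OF j(1), of x \<phi> y] by simp
    qed
    then show ?thesis using opt[of "\<lambda>j. ?g (x j)"] unfolding semidiscrete_dual_eq[OF d] by simp
  qed
  finally show ?thesis by simp
qed

subsection \<open>One step of mirror descent\<close>

text \<open>By continuity on a compact set the normalized infimum 0 is attained, at \<open>z\<close>
  say; the Lipschitz bound between \<open>y\<close> and \<open>z\<close> then gives the upper bound
  \<open>D\<^sup>2\<close>.\<close>

lemma kantorovich_potential_obtain:
  fixes x :: "nat \<Rightarrow> 'a::euclidean_space"
  assumes f: "kantorovich_potential \<Omega> \<rho> m u x f" and m: "1 \<le> m"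
    and x: "\<And>j. j \<in> {1..m} \<Longrightarrow> x j \<in> \<Omega>" and \<Omega>: "compact \<Omega>"
    and D: "\<And>y z. y \<in> \<Omega> \<Longrightarrow> z \<in> \<Omega> \<Longrightarrow> norm (y - z) \<le> D" and D0: "0 \<le> D"
  obtains \<phi> where "\<And>\<psi>. semidiscrete_dual \<Omega> \<rho> m u x \<psi> \<le> semidiscrete_dual \<Omega> \<rho> m u x \<phi>"
    and "\<And>y. y \<in> \<Omega> \<Longrightarrow> f y = semidiscrete_transform m x \<phi> y"
    and "\<And>y. y \<in> \<Omega> \<Longrightarrow> 0 \<le> semidiscrete_transform m x \<phi> y"
    and "\<And>y. y \<in> \<Omega> \<Longrightarrow> semidiscrete_transform m x \<phi> y \<le> D\<^sup>2"
proof -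
  obtain \<phi> where opt: "\<And>\<psi>. semidiscrete_dual \<Omega> \<rho> m u x \<psi> \<le> semidiscrete_dual \<Omega> \<rho> m u x \<phi>"
    and eq: "\<And>y. y \<in> \<Omega> \<Longrightarrow> f y = semidiscrete_transform m x \<phi> y" and "(INF y\<in>\<Omega>. f y) = 0"
    using f unfolding kantorovich_potential_def by blast
  then have Inf: "(INF y\<in>\<Omega>. semidiscrete_transform m x \<phi> y) = 0" by simp
  have ne: "\<Omega> \<noteq> {}" using x[of 1] m by auto
  have lip: "D-lipschitz_on \<Omega> (semidiscrete_transform m x \<phi>)"
    by (rule semidiscrete_transform_lipschitz_on[OF m x D D0])
  obtain z where z: "z \<in> \<Omega>"
    "\<And>y. y \<in> \<Omega> \<Longrightarrow> semidiscrete_transform m x \<phi> z \<le> semidiscrete_transform m x \<phi> y"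
    using continuous_attains_inf[OF \<Omega> ne lipschitz_on_continuous_on[OF lip]] by blast
  then have z0: "semidiscrete_transform m x \<phi> z = 0"
    using cInf_eq_minimum[of "semidiscrete_transform m x \<phi> z" "semidiscrete_transform m x \<phi> ` \<Omega>"] Inf
    by force
  show thesis
  proof (rule that[OF opt eq])
    fix y assume y: "y \<in> \<Omega>"
    show "0 \<le> semidiscrete_transform m x \<phi> y" using z(2)[OF y] z0 by simp
    have "\<bar>semidiscrete_transform m x \<phi> y\<bar> \<le> D * norm (y - z)"
      using lipschitz_onD[OF lip y z(1)] z0 by (simp add: dist_norm)
    also have "\<dots> \<le> D * D" using D[OF y z(1)] D0 by (rule mult_left_mono)
    finally show "semidiscrete_transform m x \<phi> y \<le> D\<^sup>2" by (simp add: power2_eq_square)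
  qed
qed

text \<open>The right-hand side times \<open>1 + t + t\<^sup>2 / 2\<close> is
  \<open>1 + t ^ 4 / 4\<close>, which is at least 1, and \<open>exp t\<close> dominates the second
  factor.\<close>

lemma exp_minus_le_quadratic:
  fixes t :: real
  assumes "0 \<le> t"
  shows "exp (- t) \<le> 1 - t + t\<^sup>2 / 2"
proof -
  have p: "0 < 1 + t + t\<^sup>2 / 2" using assms by (intro add_pos_nonneg) auto
  have "exp (- t) = 1 / exp t" by (simp add: exp_minus inverse_eq_divide)
  also have "\<dots> \<le> 1 / (1 + t + t\<^sup>2 / 2)"
    using exp_lower_Taylor_quadratic[OF assms] p by (intro divide_left_mono) auto
  also have "\<dots> \<le> 1 - t + t\<^sup>2 / 2"
  proof -
    have "(1 - t + t\<^sup>2 / 2) * (1 + t + t\<^sup>2 / 2) = 1 + (t\<^sup>2)\<^sup>2 / 4"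
      by (simp add: power2_eq_square algebra_simps)
    then show ?thesis using p by (subst pos_divide_le_eq) auto
  qed
  finally show ?thesis .
qed

lemma integrable_bounded_prob_on:
  fixes g :: "'a::euclidean_space \<Rightarrow> real"
  assumes \<nu>: "\<nu> \<in> prob_measures_on \<Omega>" and \<Omega>: "\<Omega> \<in> sets borel"
    and g: "g \<in> borel_measurable borel" and B: "\<And>y. y \<in> \<Omega> \<Longrightarrow> \<bar>g y\<bar> \<le> B"
  shows "integrable \<nu> g"
proof -
  interpret prob_space \<nu> using \<nu> by (simp add: prob_measures_on_def)
  have sets: "sets \<nu> = sets borel" using \<nu> by (simp add: prob_measures_on_def)
  show ?thesis
    using AE_in_support[OF \<nu> \<Omega>] B
    by (intro integrable_const_bound[of _ B] borel_measurable_sets_eq[OF sets g]) auto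
qed

lemma integral_mono_prob_on:
  fixes f g :: "'a::euclidean_space \<Rightarrow> real"
  assumes \<nu>: "\<nu> \<in> prob_measures_on \<Omega>" and \<Omega>: "\<Omega> \<in> sets borel"
    and "integrable \<nu> f" "integrable \<nu> g" and le: "\<And>y. y \<in> \<Omega> \<Longrightarrow> f y \<le> g y"
  shows "(\<integral>y. f y \<partial>\<nu>) \<le> (\<integral>y. g y \<partial>\<nu>)"
  using AE_in_support[OF \<nu> \<Omega>] assms by (intro integral_mono_AE) auto

text \<open>The quadratic bound on \<open>exp\<close> is integrated, using nonnegativity of
  \<open>G\<close>, and followed by \<open>ln z \<le> z - 1\<close>.\<close>

lemma ln_integral_exp_le:
  fixes G :: "'a::euclidean_space \<Rightarrow> real"
  assumes \<nu>: "\<nu> \<in> prob_measures_on \<Omega>" and \<Omega>: "\<Omega> \<in> sets borel"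
    and G: "G \<in> borel_measurable borel" and G0: "\<And>y. y \<in> \<Omega> \<Longrightarrow> 0 \<le> G y" and GM: "\<And>y. y \<in> \<Omega> \<Longrightarrow> G y \<le> M"
    and \<eta>: "0 \<le> \<eta>"
  shows "0 < (\<integral>y. exp (- \<eta> * G y) \<partial>\<nu>)"
    and "ln (\<integral>y. exp (- \<eta> * G y) \<partial>\<nu>) \<le> - \<eta> * (\<integral>y. G y \<partial>\<nu>) + \<eta>\<^sup>2 * M\<^sup>2 / 2"
    and "integrable \<nu> (\<lambda>y. exp (- \<eta> * G y))"
proof -
  interpret prob_space \<nu> using \<nu> by (simp add: prob_measures_on_def)
  note [measurable] = G
  have iG: "integrable \<nu> G"
    by (rule integrable_bounded_prob_on[OF \<nu> \<Omega> G, of M]) (use G0 GM in auto)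
  show ie: "integrable \<nu> (\<lambda>y. exp (- \<eta> * G y))"
    by (rule integrable_bounded_prob_on[OF \<nu> \<Omega>, of _ 1]) (use G0 \<eta> in auto)
  let ?Z = "\<integral>y. exp (- \<eta> * G y) \<partial>\<nu>"
  have "(\<integral>y. exp (- \<eta> * M) \<partial>\<nu>) \<le> ?Z"
    by (rule integral_mono_prob_on[OF \<nu> \<Omega> _ ie]) (use GM \<eta> in \<open>auto intro: mult_left_mono\<close>)
  then have "exp (- \<eta> * M) \<le> ?Z" by (simp add: prob_space)
  then show Z: "0 < ?Z" using exp_gt_zero[of "- \<eta> * M"] by linarith
  have "?Z \<le> (\<integral>y. 1 - \<eta> * G y + \<eta>\<^sup>2 * M\<^sup>2 / 2 \<partial>\<nu>)"
  proof (rule integral_mono_prob_on[OF \<nu> \<Omega> ie])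
    fix y assume y: "y \<in> \<Omega>"
    have "exp (- (\<eta> * G y)) \<le> 1 - \<eta> * G y + (\<eta> * G y)\<^sup>2 / 2"
      using \<eta> G0[OF y] by (intro exp_minus_le_quadratic) auto
    also have "(\<eta> * G y)\<^sup>2 \<le> \<eta>\<^sup>2 * M\<^sup>2"
      unfolding power_mult_distrib using G0[OF y] GM[OF y] by (intro mult_left_mono power_mono) auto
    finally show "exp (- \<eta> * G y) \<le> 1 - \<eta> * G y + \<eta>\<^sup>2 * M\<^sup>2 / 2" by simp
  qed (use iG in simp)
  also have "\<dots> = 1 - \<eta> * (\<integral>y. G y \<partial>\<nu>) + \<eta>\<^sup>2 * M\<^sup>2 / 2"
    using iG by (simp add: prob_space)
  finally show "ln ?Z \<le> - \<eta> * (\<integral>y. G y \<partial>\<nu>) + \<eta>\<^sup>2 * M\<^sup>2 / 2"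
    using ln_le_minus_one[OF Z] by simp
qed

text \<open>The total mass of \<nu>' is the \<nu>-integral of \<open>g\<close>. A run prescribes
  only densities, so being a probability measure has to be carried from each iterate to the
  next.\<close>

lemma has_density_on_prob_space:
  fixes \<nu> \<nu>' :: "'a::euclidean_space measure"
  assumes d: "has_density_on \<Omega> \<nu> \<rho>" and d': "has_density_on \<Omega> \<nu>' \<rho>'"
    and g: "g \<in> borel_measurable borel" and g0: "\<And>y. 0 \<le> g y" and i: "integrable \<nu> g"
    and eq: "\<And>y. y \<in> \<Omega> \<Longrightarrow> \<rho>' y = \<rho> y * g y" and 1: "(\<integral>y. g y \<partial>\<nu>) = 1"
  shows "prob_space \<nu>'"
proof (rule prob_spaceI)
  have m: "(\<lambda>y. indicator \<Omega> y * \<rho> y) \<in> borel_measurable borel" "(\<lambda>y. indicator \<Omega> y * \<rho>' y) \<in> borel_measurable borel"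
    using d d' unfolding has_density_on_def set_borel_measurable_def real_scaleR_def by blast+
  have \<nu>: "\<nu> = density lborel (\<lambda>y. ennreal (indicator \<Omega> y * \<rho> y))"
    and \<nu>': "\<nu>' = density lborel (\<lambda>y. ennreal (indicator \<Omega> y * \<rho>' y))"
    and \<rho>: "\<And>y. y \<in> \<Omega> \<Longrightarrow> 0 \<le> \<rho> y"
    using d d' by (auto simp: has_density_on_def)
  have "emeasure \<nu>' (space \<nu>') = (\<integral>\<^sup>+y. ennreal (indicator \<Omega> y * \<rho>' y) \<partial>lborel)"
    unfolding \<nu>' using m(2) by (simp add: emeasure_density)
  also have "\<dots> = (\<integral>\<^sup>+y. ennreal (indicator \<Omega> y * \<rho> y) * ennreal (g y) \<partial>lborel)"
    using eq g0 \<rho> by (intro nn_integral_cong) (auto simp: ennreal_mult split: split_indicator)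
  also have "\<dots> = (\<integral>\<^sup>+y. ennreal (g y) \<partial>\<nu>)"
    unfolding \<nu> using m(1) g by (subst nn_integral_density) auto
  also have "\<dots> = 1"
    using 1 g0 by (subst nn_integral_eq_integral[OF i]) auto
  finally show "emeasure \<nu>' (space \<nu>') = 1" .
qed

text \<open>\<open>G\<close> is the averaged potential and \<open>Z\<close> the normalizing
  constant. Convex combinations preserve the range and the Lipschitz constant of the single
  potentials, so these bounds do not depend on the iterate.\<close>

lemma mirror_descent_step_properties:
  fixes \<Omega> :: "'a::euclidean_space set" and n :: nat and w :: "nat \<Rightarrow> real"
    and m :: "nat \<Rightarrow> nat" and u :: "nat \<Rightarrow> nat \<Rightarrow> real" and x :: "nat \<Rightarrow> nat \<Rightarrow> 'a"
  defines "\<E> \<equiv> barycenter_functional n w (\<lambda>i. discrete_measure (m i) (u i) (x i))"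
  assumes \<Omega>: "compact \<Omega>"
    and u: "\<And>i j. i \<in> {1..n} \<Longrightarrow> j \<in> {1..m i} \<Longrightarrow> 0 \<le> u i j"
    and u1: "\<And>i. i \<in> {1..n} \<Longrightarrow> (\<Sum>j=1..m i. u i j) = 1"
    and x: "\<And>i j. i \<in> {1..n} \<Longrightarrow> j \<in> {1..m i} \<Longrightarrow> x i j \<in> \<Omega>"
    and w: "\<And>i. i \<in> {1..n} \<Longrightarrow> 0 \<le> w i" and w1: "(\<Sum>i=1..n. w i) = 1"
    and D: "\<And>y z. y \<in> \<Omega> \<Longrightarrow> z \<in> \<Omega> \<Longrightarrow> norm (y - z) \<le> D" and D0: "0 \<le> D"
    and \<eta>: "0 \<le> \<eta>"
    and d: "has_density_on \<Omega> \<nu> \<rho>" and \<nu>: "\<nu> \<in> prob_measures_on \<Omega>" and d': "has_density_on \<Omega> \<nu>' \<rho>'"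
    and step: "mirror_descent_step \<Omega> n w m u x \<eta> \<rho> \<rho>'"
  obtains G Z where "G \<in> borel_measurable borel" "D-lipschitz_on \<Omega> G"
    "\<And>y. y \<in> \<Omega> \<Longrightarrow> 0 \<le> G y" "\<And>y. y \<in> \<Omega> \<Longrightarrow> G y \<le> D\<^sup>2"
    "0 < Z" "\<And>y. y \<in> \<Omega> \<Longrightarrow> \<rho>' y = \<rho> y * exp (- \<eta> * G y) / Z"
    "ln Z \<le> - \<eta> * (\<integral>y. G y \<partial>\<nu>) + \<eta>\<^sup>2 * (D\<^sup>2)\<^sup>2 / 2"
    "\<nu>' \<in> prob_measures_on \<Omega>"
    "\<And>\<sigma>. \<sigma> \<in> prob_measures_on \<Omega> \<Longrightarrow> \<E> \<nu> - \<E> \<sigma> \<le> (\<integral>y. G y \<partial>\<nu>) - (\<integral>y. G y \<partial>\<sigma>)"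
proof -
  have \<Omega>b: "\<Omega> \<in> sets borel" using \<Omega> by (rule borel_compact)
  have m: "1 \<le> m i" if "i \<in> {1..n}" for i using u1[OF that] by (cases "m i") auto
  obtain f where f: "\<And>i. i \<in> {1..n} \<Longrightarrow> kantorovich_potential \<Omega> \<rho> (m i) (u i) (x i) (f i)"
    and \<rho>': "\<And>y. y \<in> \<Omega> \<Longrightarrow> \<rho>' y = \<rho> y * exp (- \<eta> * (\<Sum>i=1..n. w i * f i y)) /
             (LINT z:\<Omega>|lborel. \<rho> z * exp (- \<eta> * (\<Sum>i=1..n. w i * f i z)))"
    using step unfolding mirror_descent_step_def by blast
  have "\<exists>\<phi>. (\<forall>\<psi>. semidiscrete_dual \<Omega> \<rho> (m i) (u i) (x i) \<psi> \<le> semidiscrete_dual \<Omega> \<rho> (m i) (u i) (x i) \<phi>) \<and>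
      (\<forall>y\<in>\<Omega>. f i y = semidiscrete_transform (m i) (x i) \<phi> y \<and>
        0 \<le> semidiscrete_transform (m i) (x i) \<phi> y \<and> semidiscrete_transform (m i) (x i) \<phi> y \<le> D\<^sup>2)"
    if i: "i \<in> {1..n}" for i
    by (rule kantorovich_potential_obtain[OF f[OF i] m[OF i] x[OF i] \<Omega> D D0]) blast+
  then obtain \<phi> where
    opt: "\<And>i \<psi>. i \<in> {1..n} \<Longrightarrow>
      semidiscrete_dual \<Omega> \<rho> (m i) (u i) (x i) \<psi> \<le> semidiscrete_dual \<Omega> \<rho> (m i) (u i) (x i) (\<phi> i)"
    and \<phi>: "\<And>i y. i \<in> {1..n} \<Longrightarrow> y \<in> \<Omega> \<Longrightarrow> f i y = semidiscrete_transform (m i) (x i) (\<phi> i) y"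
      "\<And>i y. i \<in> {1..n} \<Longrightarrow> y \<in> \<Omega> \<Longrightarrow> 0 \<le> semidiscrete_transform (m i) (x i) (\<phi> i) y"
      "\<And>i y. i \<in> {1..n} \<Longrightarrow> y \<in> \<Omega> \<Longrightarrow> semidiscrete_transform (m i) (x i) (\<phi> i) y \<le> D\<^sup>2"
    by metis
  \<comment> \<open>The given \<open>f i\<close> is determined on \<Omega> only; the transform is a
    Borel function on the whole space that agrees with it there.\<close>
  define F where "F i = semidiscrete_transform (m i) (x i) (\<phi> i)" for i
  have F_meas [measurable]: "F i \<in> borel_measurable borel" for i
    unfolding F_def by (rule semidiscrete_transform_measurable)
  define G where "G y = (\<Sum>i=1..n. w i * F i y)" for y
  have G_meas [measurable]: "G \<in> borel_measurable borel" unfolding G_def by measurable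
  have fG: "(\<Sum>i=1..n. w i * f i y) = G y" if "y \<in> \<Omega>" for y
    using that \<phi>(1) by (simp add: G_def F_def)
  have G0: "0 \<le> G y" if "y \<in> \<Omega>" for y
    using that \<phi>(2) w unfolding G_def F_def by (intro sum_nonneg) auto
  have GD: "G y \<le> D\<^sup>2" if "y \<in> \<Omega>" for y
  proof -
    have "G y \<le> (\<Sum>i=1..n. w i * D\<^sup>2)"
      using that \<phi>(3) w unfolding G_def F_def by (intro sum_mono mult_left_mono) auto
    also have "\<dots> = D\<^sup>2" unfolding sum_distrib_right[symmetric] w1 by simp
    finally show ?thesis .
  qed
  have lip: "D-lipschitz_on \<Omega> G"
  proof (rule lipschitz_onI[OF _ D0])
    fix y z assume yz: "y \<in> \<Omega>" "z \<in> \<Omega>"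
    have "\<bar>G y - G z\<bar> = \<bar>\<Sum>i=1..n. w i * (F i y - F i z)\<bar>"
      by (simp add: G_def sum_subtractf right_diff_distrib)
    also have "\<dots> \<le> (\<Sum>i=1..n. w i * (D * dist y z))"
    proof (rule order_trans[OF sum_abs sum_mono])
      fix i assume i: "i \<in> {1..n}"
      have "dist (F i y) (F i z) \<le> D * dist y z"
        unfolding F_def
        by (rule lipschitz_onD[OF semidiscrete_transform_lipschitz_on[OF m[OF i] x[OF i] D D0] yz])
      then show "\<bar>w i * (F i y - F i z)\<bar> \<le> w i * (D * dist y z)"
        using w[OF i] by (simp add: abs_mult dist_norm mult_left_mono)
    qed
    also have "\<dots> = D * dist y z" unfolding sum_distrib_right[symmetric] w1 by simp
    finally show "dist (G y) (G z) \<le> D * dist y z" by (simp add: dist_norm)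
  qed
  define Z where "Z = (\<integral>y. exp (- \<eta> * G y) \<partial>\<nu>)"
  have Z: "0 < Z" "ln Z \<le> - \<eta> * (\<integral>y. G y \<partial>\<nu>) + \<eta>\<^sup>2 * (D\<^sup>2)\<^sup>2 / 2"
    and ie: "integrable \<nu> (\<lambda>y. exp (- \<eta> * G y))"
    unfolding Z_def by (rule ln_integral_exp_le[OF \<nu> \<Omega>b G_meas G0 GD \<eta>], assumption+)+
  \<comment> \<open>The Lebesgue integral normalizing the update is the \<nu>-integral of the
    exponential factor.\<close>
  have "Z = (LINT z:\<Omega>|lborel. exp (- \<eta> * G z) * \<rho> z)"
    unfolding Z_def by (rule has_density_on_integral[OF d]) simp
  also have "\<dots> = (LINT z:\<Omega>|lborel. \<rho> z * exp (- \<eta> * (\<Sum>i=1..n. w i * f i z)))"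
    unfolding set_lebesgue_integral_def using fG
    by (intro Bochner_Integration.integral_cong) (auto split: split_indicator)
  finally have eq: "\<rho>' y = \<rho> y * exp (- \<eta> * G y) / Z" if "y \<in> \<Omega>" for y
    using \<rho>'[OF that] fG[OF that] by simp
  have "prob_space \<nu>'"
  proof (rule has_density_on_prob_space[OF d d', of "\<lambda>y. exp (- \<eta> * G y) / Z"])
    show "(\<integral>y. exp (- \<eta> * G y) / Z \<partial>\<nu>) = 1" using Z(1) unfolding Z_def by simp
  qed (use Z(1) ie eq in auto)
  then have \<nu>': "\<nu>' \<in> prob_measures_on \<Omega>"
    by (rule has_density_on_prob_measures_on[OF d' _ \<Omega>b])
  \<comment> \<open>Strong duality at \<nu> and weak duality at \<sigma> with the same
    \<open>\<phi> i\<close>: the weighted sums of \<open>\<phi> i\<close> cancel.\<close>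
  have gap: "\<E> \<nu> - \<E> \<sigma> \<le> (\<integral>y. G y \<partial>\<nu>) - (\<integral>y. G y \<partial>\<sigma>)" if \<sigma>: "\<sigma> \<in> prob_measures_on \<Omega>" for \<sigma>
  proof -
    have G_int: "(\<integral>y. G y \<partial>\<tau>) = (\<Sum>i=1..n. w i * (\<integral>y. F i y \<partial>\<tau>))" if "\<tau> \<in> prob_measures_on \<Omega>" for \<tau>
      unfolding G_def F_def using integrable_semidiscrete_transform[OF that \<Omega> m]
      by (subst Bochner_Integration.integral_sum) auto
    have "\<E> \<nu> - \<E> \<sigma> = (\<Sum>i=1..n. w i * (W2_sq (discrete_measure (m i) (u i) (x i)) \<nu> / 2
        - W2_sq (discrete_measure (m i) (u i) (x i)) \<sigma> / 2))"
      by (simp add: \<E>_def barycenter_functional_def sum_subtractf right_diff_distrib)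
    also have "\<dots> \<le> (\<Sum>i=1..n. w i * ((\<integral>y. F i y \<partial>\<nu>) - (\<integral>y. F i y \<partial>\<sigma>)))"
    proof (intro sum_mono mult_left_mono w)
      fix i assume i: "i \<in> {1..n}"
      show "W2_sq (discrete_measure (m i) (u i) (x i)) \<nu> / 2
          - W2_sq (discrete_measure (m i) (u i) (x i)) \<sigma> / 2 \<le> (\<integral>y. F i y \<partial>\<nu>) - (\<integral>y. F i y \<partial>\<sigma>)"
      proof -
        have "W2_sq (discrete_measure (m i) (u i) (x i)) \<nu> / 2
            \<le> (\<Sum>j=1..m i. u i j * \<phi> i j) + (\<integral>y. F i y \<partial>\<nu>)"
          unfolding F_def by (rule strong_duality_W2_sq[OF d \<nu> \<Omega> u[OF i] u1[OF i] x[OF i] opt[OF i]])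
        moreover have "(\<Sum>j=1..m i. u i j * \<phi> i j) + (\<integral>y. F i y \<partial>\<sigma>)
            \<le> W2_sq (discrete_measure (m i) (u i) (x i)) \<sigma> / 2"
          unfolding F_def by (rule weak_duality_W2_sq[OF u[OF i] u1[OF i] x[OF i] \<Omega> \<sigma>])
        ultimately show ?thesis by simp
      qed
    qed
    also have "\<dots> = (\<integral>y. G y \<partial>\<nu>) - (\<integral>y. G y \<partial>\<sigma>)"
      by (simp add: G_int[OF \<nu>] G_int[OF \<sigma>] sum_subtractf right_diff_distrib)
    finally show ?thesis .
  qed
  show thesis by (rule that[OF G_meas lip G0 GD Z(1) eq Z(2) \<nu>' gap])
qed

subsection \<open>Regret of mirror descent\<close>

lemma emeasure_lborel_shrink:
  fixes \<Omega> :: "'a::euclidean_space set"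
  assumes \<Omega>: "compact \<Omega>" and \<epsilon>: "0 \<le> \<epsilon>"
  shows "emeasure lborel ((\<lambda>y. \<epsilon> *\<^sub>R y + c) ` \<Omega>) = ennreal (\<epsilon> ^ DIM('a) * measure lborel \<Omega>)"
proof -
  have S: "(\<lambda>y. \<epsilon> *\<^sub>R y + c) ` \<Omega> \<in> sets borel"
    by (intro borel_compact compact_continuous_image \<Omega> continuous_intros)
  have "emeasure lborel ((\<lambda>y. \<epsilon> *\<^sub>R y + c) ` \<Omega>) = \<bar>\<epsilon>\<bar> ^ DIM('a) * emeasure lborel \<Omega>"
    using emeasure_lebesgue_affine[of \<epsilon> c \<Omega>] S borel_compact[OF \<Omega>] by simp
  also have "emeasure lborel \<Omega> = ennreal (measure lborel \<Omega>)"
    using emeasure_compact_finite[OF \<Omega>] by (intro emeasure_eq_ennreal_measure) simp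
  finally show ?thesis using \<epsilon> by (simp add: ennreal_mult)
qed

text \<open>The exponential weights \<open>\<rho>\<^sub>T = \<rho>\<^sub>0 exp (- F) / P\<close>, with \<open>F\<close> Lipschitz, have total mass one; looking only
  at the \<open>\<epsilon>\<close>-contraction of \<open>\<Omega>\<close> towards a minimizer of \<open>F\<close> bounds \<open>P\<close> from below.\<close>

lemma exponential_weights_lower_bound:
  fixes \<Omega> :: "'a::euclidean_space set"
  assumes \<Omega>: "compact \<Omega>" "convex \<Omega>" and d: "has_density_on \<Omega> \<nu> \<rho>" and \<nu>: "prob_space \<nu>"
    and eq: "\<And>y. y \<in> \<Omega> \<Longrightarrow> \<rho> y = \<rho>0 y * exp (- F y - lnP)"
    and a: "0 < a" "\<And>y. y \<in> \<Omega> \<Longrightarrow> a \<le> \<rho>0 y"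
    and lip: "L-lipschitz_on \<Omega> F" and y0: "y0 \<in> \<Omega>"
    and D: "\<And>y z. y \<in> \<Omega> \<Longrightarrow> z \<in> \<Omega> \<Longrightarrow> norm (y - z) \<le> D"
    and \<epsilon>: "0 < \<epsilon>" "\<epsilon> \<le> 1" and V: "0 < measure lborel \<Omega>"
  shows "- lnP \<le> F y0 + L * (\<epsilon> * D) - ln (a * measure lborel \<Omega>) - real DIM('a) * ln \<epsilon>"
proof -
  interpret prob_space \<nu> by fact
  \<comment> \<open>By convexity the contracted copy stays in \<Omega>; its points are within
    \<open>\<epsilon> * D\<close> of \<open>y0\<close>, and its volume is that of \<Omega> times
    \<open>\<epsilon> ^ DIM('a)\<close>.\<close>
  define S where "S = (\<lambda>y. \<epsilon> *\<^sub>R y + (1 - \<epsilon>) *\<^sub>R y0) ` \<Omega>"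
  have S_borel: "S \<in> sets borel" unfolding S_def
    by (intro borel_compact compact_continuous_image \<Omega> continuous_intros)
  have S\<Omega>: "S \<subseteq> \<Omega>"
    using convexD[OF \<Omega>(2) _ y0, of _ \<epsilon> "1 - \<epsilon>"] \<epsilon> by (auto simp: S_def)
  have L0: "0 \<le> L" using lip by (rule lipschitz_on_nonneg)
  have F_le: "F y \<le> F y0 + L * (\<epsilon> * D)" if "y \<in> S" for y
  proof -
    obtain z where z: "z \<in> \<Omega>" "y = \<epsilon> *\<^sub>R z + (1 - \<epsilon>) *\<^sub>R y0" using \<open>y \<in> S\<close> by (auto simp: S_def)
    have "y - y0 = \<epsilon> *\<^sub>R (z - y0)" using z(2) by (simp add: algebra_simps)
    then have "dist y y0 \<le> \<epsilon> * D"
      using D[OF z(1) y0] \<epsilon> by (simp add: dist_norm mult_left_mono)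
    then have "L * dist y y0 \<le> L * (\<epsilon> * D)" using L0 by (rule mult_left_mono)
    moreover have "F y - F y0 \<le> dist (F y) (F y0)" by (simp add: dist_norm)
    ultimately show ?thesis
      using lipschitz_onD[OF lip _ y0, of y] S\<Omega> \<open>y \<in> S\<close> by fastforce
  qed
  define c where "c = a * exp (- (F y0 + L * (\<epsilon> * D)) - lnP)"
  have c: "0 < c" using a(1) by (simp add: c_def)
  have c_le: "c \<le> \<rho> y" if "y \<in> S" for y
  proof -
    have y: "y \<in> \<Omega>" using that S\<Omega> by blast
    have "c \<le> \<rho>0 y * exp (- F y - lnP)"
      unfolding c_def using a F_le[OF that] a(2)[OF y] by (intro mult_mono) auto
    then show ?thesis using eq[OF y] by simp
  qed
  have m: "(\<lambda>y. indicator \<Omega> y * \<rho> y) \<in> borel_measurable borel"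
    using d unfolding has_density_on_def set_borel_measurable_def real_scaleR_def by blast
  have \<nu>_def: "\<nu> = density lborel (\<lambda>y. ennreal (indicator \<Omega> y * \<rho> y))"
    using d by (simp add: has_density_on_def)
  \<comment> \<open>On \<open>S\<close> the density is at least \<open>c\<close>, so
    \<open>c\<close> times the volume of \<open>S\<close> is at most the total mass one; taking
    logarithms gives the claim.\<close>
  have "ennreal (c * (\<epsilon> ^ DIM('a) * measure lborel \<Omega>)) = ennreal c * emeasure lborel S"
    using emeasure_lborel_shrink[OF \<Omega>(1), of \<epsilon> "(1 - \<epsilon>) *\<^sub>R y0"] \<epsilon> c
    by (simp add: S_def ennreal_mult)
  also have "\<dots> = (\<integral>\<^sup>+y. ennreal c * indicator S y \<partial>lborel)"
    using S_borel by (subst nn_integral_cmult_indicator) auto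
  also have "\<dots> \<le> (\<integral>\<^sup>+y. ennreal (indicator \<Omega> y * \<rho> y) \<partial>lborel)"
    using c_le S\<Omega> by (intro nn_integral_mono) (auto split: split_indicator intro: ennreal_leI)
  also have "\<dots> = emeasure \<nu> (space \<nu>)"
    unfolding \<nu>_def using m by (simp add: emeasure_density)
  also have "\<dots> = ennreal 1" using emeasure_space_1 by simp
  finally have le1: "c * (\<epsilon> ^ DIM('a) * measure lborel \<Omega>) \<le> 1" by (simp only: ennreal_le_iff)
  have "ln (c * (\<epsilon> ^ DIM('a) * measure lborel \<Omega>)) \<le> 0"
    using le1 c \<epsilon> V by (subst ln_le_zero_iff) auto
  moreover have "ln (c * (\<epsilon> ^ DIM('a) * measure lborel \<Omega>))
      = ln a - (F y0 + L * (\<epsilon> * D)) - lnP + (real DIM('a) * ln \<epsilon> + ln (measure lborel \<Omega>))"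
    using c \<epsilon> V a(1) by (simp add: c_def ln_mult ln_realpow)
  moreover have "ln (a * measure lborel \<Omega>) = ln a + ln (measure lborel \<Omega>)"
    using a(1) V by (simp add: ln_mult)
  ultimately show ?thesis by simp
qed

text \<open>The factor \<epsilon> stays free: the first term is the loss from moving away from a
  minimizer of the accumulated potential, and \<open>- DIM('a) * ln \<epsilon>\<close> is the price
  for the smaller volume.\<close>

lemma mirror_descent_regret:
  fixes \<Omega> :: "'a::euclidean_space set" and n :: nat and w :: "nat \<Rightarrow> real"
    and m :: "nat \<Rightarrow> nat" and u :: "nat \<Rightarrow> nat \<Rightarrow> real" and x :: "nat \<Rightarrow> nat \<Rightarrow> 'a"
  defines "\<E> \<equiv> barycenter_functional n w (\<lambda>i. discrete_measure (m i) (u i) (x i))"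
  assumes \<Omega>: "compact \<Omega>" "convex \<Omega>"
    and u: "\<And>i j. i \<in> {1..n} \<Longrightarrow> j \<in> {1..m i} \<Longrightarrow> 0 \<le> u i j"
    and u1: "\<And>i. i \<in> {1..n} \<Longrightarrow> (\<Sum>j=1..m i. u i j) = 1"
    and x: "\<And>i j. i \<in> {1..n} \<Longrightarrow> j \<in> {1..m i} \<Longrightarrow> x i j \<in> \<Omega>"
    and w: "\<And>i. i \<in> {1..n} \<Longrightarrow> 0 \<le> w i" and w1: "(\<Sum>i=1..n. w i) = 1"
    and D: "\<And>y z. y \<in> \<Omega> \<Longrightarrow> z \<in> \<Omega> \<Longrightarrow> norm (y - z) \<le> D" and D0: "0 \<le> D"
    and \<eta>: "\<And>k. 0 \<le> \<eta> k"
    and a: "0 < a" "\<And>y. y \<in> \<Omega> \<Longrightarrow> a \<le> \<rho>0 y"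
    and run: "mirror_descent_run \<Omega> n w m u x \<rho>0 \<eta> T \<nu> \<rho>" and \<nu>0: "\<nu> 0 \<in> prob_measures_on \<Omega>"
    and \<sigma>: "\<sigma> \<in> prob_measures_on \<Omega>"
    and \<epsilon>: "0 < \<epsilon>" "\<epsilon> \<le> 1" and V: "0 < measure lborel \<Omega>"
  shows "(\<Sum>k<T. \<eta> k * (\<E> (\<nu> k) - \<E> \<sigma>)) \<le> D\<^sup>2 * \<epsilon> * (\<Sum>k<T. \<eta> k)
      - ln (a * measure lborel \<Omega>) - real DIM('a) * ln \<epsilon> + D ^ 4 / 2 * (\<Sum>k<T. (\<eta> k)\<^sup>2)"
proof -
  have \<Omega>b: "\<Omega> \<in> sets borel" using \<Omega>(1) by (rule borel_compact)
  have init: "\<And>y. y \<in> \<Omega> \<Longrightarrow> \<rho> 0 y = \<rho>0 y"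
    and d: "\<And>k. k \<le> T \<Longrightarrow> has_density_on \<Omega> (\<nu> k) (\<rho> k)"
    and step: "\<And>k. k < T \<Longrightarrow> mirror_descent_step \<Omega> n w m u x (\<eta> k) (\<rho> k) (\<rho> (Suc k))"
    using run by (auto simp: mirror_descent_run_def)
  have \<nu>: "\<nu> k \<in> prob_measures_on \<Omega>" if "k \<le> T" for k
    using that
  proof (induction k)
    case (Suc k)
    then have k: "k < T" "k \<le> T" "Suc k \<le> T" "\<nu> k \<in> prob_measures_on \<Omega>" by auto
    show ?case
      by (rule mirror_descent_step_properties[OF \<Omega>(1) u u1 x w w1 D D0 \<eta> d[OF k(2)] k(4) d[OF k(3)] step[OF k(1)]])
  qed (rule \<nu>0)
  \<comment> \<open>One predicate for all conclusions lets the sequences \<open>G\<close> and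
    \<open>Z\<close> be chosen together.\<close>
  define good where "good k G Z \<longleftrightarrow> G \<in> borel_measurable borel \<and> D-lipschitz_on \<Omega> G \<and>
      (\<forall>y\<in>\<Omega>. 0 \<le> G y \<and> G y \<le> D\<^sup>2) \<and>
      0 < Z \<and> (\<forall>y\<in>\<Omega>. \<rho> (Suc k) y = \<rho> k y * exp (- \<eta> k * G y) / Z) \<and>
      ln Z \<le> - \<eta> k * (\<integral>y. G y \<partial>\<nu> k) + (\<eta> k)\<^sup>2 * (D\<^sup>2)\<^sup>2 / 2 \<and>
      \<E> (\<nu> k) - \<E> \<sigma> \<le> (\<integral>y. G y \<partial>\<nu> k) - (\<integral>y. G y \<partial>\<sigma>)" for k G Z
  have "\<exists>G Z. good k G Z" if k: "k < T" for k
  proof -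
    have k': "k \<le> T" "Suc k \<le> T" using k by auto
    show ?thesis unfolding good_def
      by (rule mirror_descent_step_properties[OF \<Omega>(1) u u1 x w w1 D D0 \<eta> d[OF k'(1)] \<nu>[OF k'(1)] d[OF k'(2)] step[OF k], folded \<E>_def])
        (use \<sigma> in blast)+
  qed
  then obtain G Z where "\<And>k. k < T \<Longrightarrow> good k (G k) (Z k)" by metis
  then have G_meas: "\<And>k. k < T \<Longrightarrow> G k \<in> borel_measurable borel"
    and lip: "\<And>k. k < T \<Longrightarrow> D-lipschitz_on \<Omega> (G k)"
    and G: "\<And>k y. k < T \<Longrightarrow> y \<in> \<Omega> \<Longrightarrow> 0 \<le> G k y" "\<And>k y. k < T \<Longrightarrow> y \<in> \<Omega> \<Longrightarrow> G k y \<le> D\<^sup>2"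
    and Z: "\<And>k. k < T \<Longrightarrow> 0 < Z k"
    and \<rho>: "\<And>k y. k < T \<Longrightarrow> y \<in> \<Omega> \<Longrightarrow> \<rho> (Suc k) y = \<rho> k y * exp (- \<eta> k * G k y) / Z k"
    and lnZ: "\<And>k. k < T \<Longrightarrow> ln (Z k) \<le> - \<eta> k * (\<integral>y. G k y \<partial>\<nu> k) + (\<eta> k)\<^sup>2 * (D\<^sup>2)\<^sup>2 / 2"
    and gap: "\<And>k. k < T \<Longrightarrow> \<E> (\<nu> k) - \<E> \<sigma> \<le> (\<integral>y. G k y \<partial>\<nu> k) - (\<integral>y. G k y \<partial>\<sigma>)"
    unfolding good_def by blast+
  define F where "F y = (\<Sum>k<T. \<eta> k * G k y)" for y
  \<comment> \<open>Normalizing constants are kept as logarithms, so that at \<open>k = T\<close>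
    their sum is the shift \<open>lnP\<close> of
    \<open>exponential_weights_lower_bound\<close>.\<close>
  have closed_form: "\<rho> k y = \<rho>0 y * exp (- (\<Sum>l<k. \<eta> l * G l y) - (\<Sum>l<k. ln (Z l)))"
    if "y \<in> \<Omega>" "k \<le> T" for k y
    using that(2)
  proof (induction k)
    case (Suc k)
    then have "\<rho> (Suc k) y
        = \<rho>0 y * exp (- (\<Sum>l<k. \<eta> l * G l y) - (\<Sum>l<k. ln (Z l))) * exp (- \<eta> k * G k y) / Z k"
      using \<rho>[OF _ that(1)] by simp
    also have "\<dots> = \<rho>0 y * (exp (- (\<Sum>l<k. \<eta> l * G l y) - (\<Sum>l<k. ln (Z l)))
        * exp (- \<eta> k * G k y) * exp (- ln (Z k)))"
      using Z[of k] Suc.prems by (simp add: exp_minus inverse_eq_divide)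
    also have "\<dots> = \<rho>0 y * exp (- (\<Sum>l<Suc k. \<eta> l * G l y) - (\<Sum>l<Suc k. ln (Z l)))"
      unfolding exp_add[symmetric] by simp
    finally show ?case .
  qed (use init[OF that(1)] in simp)
  have F_lip: "(D * (\<Sum>k<T. \<eta> k))-lipschitz_on \<Omega> F"
  proof (rule lipschitz_onI)
    fix y z assume yz: "y \<in> \<Omega>" "z \<in> \<Omega>"
    have "\<bar>F y - F z\<bar> = \<bar>\<Sum>k<T. \<eta> k * (G k y - G k z)\<bar>"
      by (simp add: F_def sum_subtractf right_diff_distrib)
    also have "\<dots> \<le> (\<Sum>k<T. \<eta> k * (D * dist y z))"
    proof (rule order_trans[OF sum_abs sum_mono])
      fix k assume "k \<in> {..<T}"
      then have "dist (G k y) (G k z) \<le> D * dist y z" by (intro lipschitz_onD[OF lip yz]) simp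
      then show "\<bar>\<eta> k * (G k y - G k z)\<bar> \<le> \<eta> k * (D * dist y z)"
        using \<eta>[of k] by (simp add: abs_mult dist_norm mult_left_mono)
    qed
    also have "\<dots> = D * (\<Sum>k<T. \<eta> k) * dist y z" by (simp add: sum_distrib_right[symmetric])
    finally show "dist (F y) (F z) \<le> D * (\<Sum>k<T. \<eta> k) * dist y z" by (simp add: dist_norm)
  qed (use D0 \<eta> in \<open>auto intro!: mult_nonneg_nonneg sum_nonneg\<close>)
  have "\<Omega> \<noteq> {}" using V by auto
  then obtain y0 where y0: "y0 \<in> \<Omega>" "\<And>y. y \<in> \<Omega> \<Longrightarrow> F y0 \<le> F y"
    using continuous_attains_inf[OF \<Omega>(1) _ lipschitz_on_continuous_on[OF F_lip]] by blast
  have iG: "integrable \<sigma> (G k)" if "k < T" for k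
    by (rule integrable_bounded_prob_on[OF \<sigma> \<Omega>b G_meas[OF that], of "D\<^sup>2"]) (use G that in auto)
  then have iF: "integrable \<sigma> F" unfolding F_def by auto
  interpret \<sigma>: prob_space \<sigma> using \<sigma> by (simp add: prob_measures_on_def)
  \<comment> \<open>Only mass one and support in \<Omega> enter for \<sigma>, so it may be
    singular.\<close>
  have "(\<integral>y. F y0 \<partial>\<sigma>) \<le> (\<integral>y. F y \<partial>\<sigma>)"
    by (rule integral_mono_prob_on[OF \<sigma> \<Omega>b _ iF y0(2)]) auto
  then have F_ge: "F y0 \<le> (\<Sum>k<T. \<eta> k * (\<integral>y. G k y \<partial>\<sigma>))"
    using iG by (simp add: \<sigma>.prob_space F_def)
  have "(\<Sum>k<T. \<eta> k * (\<E> (\<nu> k) - \<E> \<sigma>)) \<le> (\<Sum>k<T. \<eta> k * ((\<integral>y. G k y \<partial>\<nu> k) - (\<integral>y. G k y \<partial>\<sigma>)))"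
    using gap \<eta> by (intro sum_mono mult_left_mono) auto
  also have "\<dots> \<le> (\<Sum>k<T. D ^ 4 / 2 * (\<eta> k)\<^sup>2 - ln (Z k) - \<eta> k * (\<integral>y. G k y \<partial>\<sigma>))"
  proof (rule sum_mono)
    fix k assume "k \<in> {..<T}"
    then show "\<eta> k * ((\<integral>y. G k y \<partial>\<nu> k) - (\<integral>y. G k y \<partial>\<sigma>)) \<le> D ^ 4 / 2 * (\<eta> k)\<^sup>2 - ln (Z k) - \<eta> k * (\<integral>y. G k y \<partial>\<sigma>)"
      using lnZ[of k] by (simp add: right_diff_distrib power_mult[symmetric] mult.commute)
  qed
  also have "\<dots> = D ^ 4 / 2 * (\<Sum>k<T. (\<eta> k)\<^sup>2) - (\<Sum>k<T. ln (Z k)) - (\<Sum>k<T. \<eta> k * (\<integral>y. G k y \<partial>\<sigma>))"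
    by (simp add: sum_subtractf sum_distrib_left)
  also have "\<dots> \<le> D ^ 4 / 2 * (\<Sum>k<T. (\<eta> k)\<^sup>2) - (\<Sum>k<T. ln (Z k)) - F y0"
    using F_ge by simp
  finally have "(\<Sum>k<T. \<eta> k * (\<E> (\<nu> k) - \<E> \<sigma>))
      \<le> D ^ 4 / 2 * (\<Sum>k<T. (\<eta> k)\<^sup>2) - (\<Sum>k<T. ln (Z k)) - F y0" .
  moreover have "- (\<Sum>k<T. ln (Z k)) \<le> F y0 + D * (\<Sum>k<T. \<eta> k) * (\<epsilon> * D) - ln (a * measure lborel \<Omega>) - real DIM('a) * ln \<epsilon>"
  proof (rule exponential_weights_lower_bound[OF \<Omega> d[OF order_refl] _ _ a F_lip y0(1) D \<epsilon> V])
    show "prob_space (\<nu> T)" using \<nu>[of T] by (simp add: prob_measures_on_def)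
    show "\<rho> T y = \<rho>0 y * exp (- F y - (\<Sum>k<T. ln (Z k)))" if "y \<in> \<Omega>" for y
      using closed_form[OF that order_refl] by (simp add: F_def)
  qed
  ultimately show ?thesis by (simp add: power2_eq_square algebra_simps)
qed

section \<open>From regret to the convergence rate\<close>

text \<open>\<open>ln z \<le> z - 1\<close> at \<open>z = T / (T + 1)\<close> bounds each new term
  by an increment of the logarithm.\<close>

lemma sum_inverse_Suc_le: "1 \<le> T \<Longrightarrow> (\<Sum>k<T. 1 / (real k + 1)) \<le> 1 + ln (real T)"
proof (induction T rule: dec_induct)
  case (step T)
  have "1 / (real T + 1) \<le> - ln (1 - 1 / (real T + 1))"
    using ln_le_minus_one[of "1 - 1 / (real T + 1)"] step.hyps by (simp add: field_simps)
  also have "1 - 1 / (real T + 1) = real T / (real T + 1)" by (simp add: field_simps)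
  also have "- ln (real T / (real T + 1)) = ln (real (Suc T)) - ln (real T)"
    using step.hyps by (subst ln_div) (auto simp: add.commute)
  finally show ?case using step.IH by simp
qed simp

text \<open>The conditions on \<open>\<eta>\<close> cover both step-size rules. The lower bound
  turns regret into a bound on the smallest gap, the upper bound keeps the Lipschitz constant of the
  accumulated potential of order \<open>T\<close>, and the square sum controls the second-order
  terms.\<close>

lemma mirror_descent_rate:
  fixes \<Omega> :: "'a::euclidean_space set" and n :: nat and w :: "nat \<Rightarrow> real"
    and m :: "nat \<Rightarrow> nat" and u :: "nat \<Rightarrow> nat \<Rightarrow> real" and x :: "nat \<Rightarrow> nat \<Rightarrow> 'a"
    and \<eta> :: "nat \<Rightarrow> nat \<Rightarrow> real"
  defines "\<E> \<equiv> barycenter_functional n w (\<lambda>i. discrete_measure (m i) (u i) (x i))"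
  assumes \<Omega>: "compact \<Omega>" "convex \<Omega>"
    and u: "\<And>i j. i \<in> {1..n} \<Longrightarrow> j \<in> {1..m i} \<Longrightarrow> 0 \<le> u i j"
    and u1: "\<And>i. i \<in> {1..n} \<Longrightarrow> (\<Sum>j=1..m i. u i j) = 1"
    and x: "\<And>i j. i \<in> {1..n} \<Longrightarrow> j \<in> {1..m i} \<Longrightarrow> x i j \<in> \<Omega>"
    and w: "\<And>i. i \<in> {1..n} \<Longrightarrow> 0 \<le> w i" and w1: "(\<Sum>i=1..n. w i) = 1"
    and \<sigma>: "\<sigma> \<in> prob_measures_on \<Omega>"
    and \<nu>0: "\<nu>0 \<in> prob_measures_on \<Omega>" and d0: "has_density_on \<Omega> \<nu>0 \<rho>0"
    and a: "0 < a" "\<And>y. y \<in> \<Omega> \<Longrightarrow> a \<le> \<rho>0 y"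
    and \<eta>: "\<And>T k. 0 \<le> \<eta> T k" "\<And>T k. \<eta> T k \<le> 1" "\<And>T k. k < T \<Longrightarrow> 1 / sqrt (real T) \<le> \<eta> T k"
    and \<eta>2: "\<And>T. 2 \<le> T \<Longrightarrow> (\<Sum>k<T. (\<eta> T k)\<^sup>2) \<le> 1 + ln (real T)"
  shows "\<exists>C. \<forall>T\<ge>2. \<forall>\<nu> \<rho>. mirror_descent_run \<Omega> n w m u x \<rho>0 (\<eta> T) T \<nu> \<rho> \<longrightarrow>
               (MIN k\<in>{0..T}. \<E> (\<nu> k) - \<E> \<sigma>) \<le> C * ln (real T) / sqrt (real T)"
proof -
  define D where "D = diameter \<Omega>"
  have D: "norm (y - z) \<le> D" if "y \<in> \<Omega>" "z \<in> \<Omega>" for y z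
    using diameter_bounded_bound[OF compact_imp_bounded[OF \<Omega>(1)] that] by (simp add: D_def dist_norm)
  have D0: "0 \<le> D" unfolding D_def by (rule diameter_ge_0[OF compact_imp_bounded[OF \<Omega>(1)]])
  define V where "V = measure lborel \<Omega>"
  \<comment> \<open>A null set \<Omega> could not carry the absolutely continuous probability
    measure \<open>\<nu>0\<close>.\<close>
  have V: "0 < V"
  proof (rule ccontr)
    assume "\<not> 0 < V"
    then have "measure lborel \<Omega> = 0" using measure_nonneg[of lborel \<Omega>] by (simp add: V_def)
    then have "\<Omega> \<in> null_sets lborel"
      using borel_compact[OF \<Omega>(1)] emeasure_compact_finite[OF \<Omega>(1)]
      by (simp add: null_sets_def emeasure_eq_ennreal_measure)
    then have N: "\<Omega> \<in> null_sets \<nu>0" by (rule has_density_on_null[OF d0])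
    interpret prob_space \<nu>0 using \<nu>0 by (simp add: prob_measures_on_def)
    have "AE y in \<nu>0. y \<notin> \<Omega>" by (rule AE_not_in[OF N])
    then have "AE y in \<nu>0. False"
      using AE_in_support[OF \<nu>0 borel_compact[OF \<Omega>(1)]] by eventually_elim simp
    then show False by simp
  qed
  \<comment> \<open>\<open>K\<close> collects the terms free of \<open>T\<close>; since
    \<open>T \<ge> 2\<close>, they are at most \<open>K / ln 2\<close> times
    \<open>ln T\<close>.\<close>
  define K where "K = D\<^sup>2 + \<bar>ln (a * V)\<bar> + D ^ 4 / 2"
  define C where "C = K / ln 2 + real DIM('a) + D ^ 4 / 2"
  have K0: "0 \<le> K" by (simp add: K_def)
  then have C0: "0 \<le> C" by (simp add: C_def)
  have "(MIN k\<in>{0..T}. \<E> (\<nu> k) - \<E> \<sigma>) \<le> C * ln (real T) / sqrt (real T)"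
    if T: "2 \<le> T" and run: "mirror_descent_run \<Omega> n w m u x \<rho>0 (\<eta> T) T \<nu> \<rho>" for T \<nu> \<rho>
  proof -
    let ?M = "MIN k\<in>{0..T}. \<E> (\<nu> k) - \<E> \<sigma>"
    have lnT: "ln 2 \<le> ln (real T)" using T by simp
    have "\<nu> 0 = density lborel (\<lambda>y. ennreal (indicator \<Omega> y * \<rho> 0 y))"
      using run by (simp add: mirror_descent_run_def has_density_on_def)
    also have "\<dots> = \<nu>0"
      using run d0 unfolding mirror_descent_run_def has_density_on_def
      by (auto intro!: arg_cong[of _ _ "density lborel"] split: split_indicator)
    finally have \<nu>_0: "\<nu> 0 \<in> prob_measures_on \<Omega>" using \<nu>0 by simp
    have "(\<Sum>k<T. \<eta> T k) \<le> real T"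
      using sum_mono[of "{..<T}" "\<eta> T" "\<lambda>_. 1"] \<eta>(2) by simp
    then have "D\<^sup>2 * (1 / real T) * (\<Sum>k<T. \<eta> T k) \<le> D\<^sup>2 * (1 / real T) * real T"
      by (intro mult_left_mono) auto
    then have s1: "D\<^sup>2 * (1 / real T) * (\<Sum>k<T. \<eta> T k) \<le> D\<^sup>2" using T by simp
    have s2: "D ^ 4 / 2 * (\<Sum>k<T. (\<eta> T k)\<^sup>2) \<le> D ^ 4 / 2 * (1 + ln (real T))"
      using \<eta>2[OF T] by (intro mult_left_mono) auto
    \<comment> \<open>With \<open>\<epsilon> = 1 / T\<close> the Lipschitz term is bounded by
      \<open>s1\<close>, and the volume term costs \<open>DIM('a) * ln T\<close>.\<close>
    have "(\<Sum>k<T. \<eta> T k * (\<E> (\<nu> k) - \<E> \<sigma>)) \<le> D\<^sup>2 * (1 / real T) * (\<Sum>k<T. \<eta> T k)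
      - ln (a * V) - real DIM('a) * ln (1 / real T) + D ^ 4 / 2 * (\<Sum>k<T. (\<eta> T k)\<^sup>2)"
      unfolding \<E>_def V_def
      by (rule mirror_descent_regret[OF \<Omega> u u1 x w w1 D D0 \<eta>(1) a run \<nu>_0 \<sigma> _ _ V[unfolded V_def]])
        (use T in auto)
    also have "\<dots> \<le> K + real DIM('a) * ln (real T) + D ^ 4 / 2 * ln (real T)"
      using s1 s2 T by (simp add: K_def ln_div distrib_left)
    also have "\<dots> \<le> C * ln (real T)"
    proof -
      have "K = K / ln 2 * ln 2" by simp
      also have "\<dots> \<le> K / ln 2 * ln (real T)" using K0 lnT by (intro mult_left_mono) auto
      finally show ?thesis by (simp add: C_def distrib_right)
    qed
    finally have regret: "(\<Sum>k<T. \<eta> T k * (\<E> (\<nu> k) - \<E> \<sigma>)) \<le> C * ln (real T)" .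
    show ?thesis
    \<comment> \<open>Replacing the steps by their lower bound requires a nonnegative minimum; a
      negative one satisfies the claim since \<open>C\<close> is nonnegative. The regret runs over
      \<open>k < T\<close>, and including \<open>k = T\<close> can only lower the minimum.\<close>
    proof (cases "0 \<le> ?M")
      case True
      have "real T / sqrt (real T) = sqrt (real T)" by (rule real_div_sqrt) simp
      then have "sqrt (real T) * ?M = real T / sqrt (real T) * ?M" by (simp only:)
      also have "\<dots> = (\<Sum>k<T. 1 / sqrt (real T) * ?M)" by simp
      also have "\<dots> \<le> (\<Sum>k<T. \<eta> T k * (\<E> (\<nu> k) - \<E> \<sigma>))"
      proof (rule sum_mono)
        fix k assume "k \<in> {..<T}"
        then show "1 / sqrt (real T) * ?M \<le> \<eta> T k * (\<E> (\<nu> k) - \<E> \<sigma>)"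
          using \<eta>(3)[of k T] \<eta>(1)[of T k] True by (intro mult_mono) auto
      qed
      also note regret
      finally show ?thesis using T by (simp add: pos_le_divide_eq mult.commute)
    next
      case False
      moreover have "0 \<le> C * ln (real T) / sqrt (real T)" using C0 T by simp
      ultimately show ?thesis by linarith
    qed
  qed
  then show ?thesis by blast
qed

theorem theorem4p2:
  fixes \<Omega> :: "'a::euclidean_space set"
    and n :: nat and w :: "nat \<Rightarrow> real"
    and m :: "nat \<Rightarrow> nat" and u :: "nat \<Rightarrow> nat \<Rightarrow> real" and x :: "nat \<Rightarrow> nat \<Rightarrow> 'a"
    and r a b :: real
    and \<rho>0 :: "'a \<Rightarrow> real" and \<nu>0 \<nu>star :: "'a measure"
  defines "\<E> \<equiv> barycenter_functional n w (\<lambda>i. discrete_measure (m i) (u i) (x i))"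
  assumes "compact \<Omega>" and "convex \<Omega>"
    and "\<And>i j. i \<in> {1..n} \<Longrightarrow> j \<in> {1..m i} \<Longrightarrow> 0 \<le> u i j"
    and "\<And>i. i \<in> {1..n} \<Longrightarrow> (\<Sum>j=1..m i. u i j) = 1"
    and "\<And>i j. i \<in> {1..n} \<Longrightarrow> j \<in> {1..m i} \<Longrightarrow> x i j \<in> \<Omega>"
    and "\<And>i. i \<in> {1..n} \<Longrightarrow> 0 \<le> w i" and "(\<Sum>i=1..n. w i) = 1"
    and "is_arg_min \<E> (\<lambda>\<nu>. \<nu> \<in> prob_measures_on \<Omega>) \<nu>star"
    and "0 < r"
    and "\<And>i j. i \<in> {1..n} \<Longrightarrow> j \<in> {1..m i} \<Longrightarrow> r \<le> infdist (x i j) (frontier \<Omega>)"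
    and "\<nu>0 \<in> ac_prob_measures_on \<Omega>" and "has_density_on \<Omega> \<nu>0 \<rho>0"
    and "0 < a" and "\<And>y. y \<in> \<Omega> \<Longrightarrow> a \<le> \<rho>0 y" and "\<And>y. y \<in> \<Omega> \<Longrightarrow> \<rho>0 y \<le> b"
  shows "(\<exists>C. \<forall>T::nat. real T \<ge> max 2 (4 * real DIM('a) / r\<^sup>2) \<longrightarrow>
            (\<forall>\<nu> \<rho>. mirror_descent_run \<Omega> n w m u x \<rho>0 (\<lambda>k. 1 / sqrt (real k + 1)) T \<nu> \<rho> \<longrightarrow>
               (MIN k\<in>{0..T}. \<E> (\<nu> k) - \<E> \<nu>star) \<le> C * ln (real T) / sqrt (real T)))
       \<and> (\<exists>C. \<forall>T::nat. real T \<ge> max 2 (4 * real DIM('a) / r\<^sup>2) \<longrightarrow>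
            (\<forall>\<nu> \<rho>. mirror_descent_run \<Omega> n w m u x \<rho>0 (\<lambda>k. 1 / sqrt (real T)) T \<nu> \<rho> \<longrightarrow>
               (MIN k\<in>{0..T}. \<E> (\<nu> k) - \<E> \<nu>star) \<le> C * ln (real T) / sqrt (real T)))"
proof -
  have \<sigma>: "\<nu>star \<in> prob_measures_on \<Omega>" using assms(9) by (simp add: is_arg_min_def)
  have \<nu>0: "\<nu>0 \<in> prob_measures_on \<Omega>" using assms(12) by (simp add: ac_prob_measures_on_def)
  have "\<exists>C. \<forall>T\<ge>2. \<forall>\<nu> \<rho>. mirror_descent_run \<Omega> n w m u x \<rho>0 (\<lambda>k. 1 / sqrt (real k + 1)) T \<nu> \<rho> \<longrightarrow>
      (MIN k\<in>{0..T}. \<E> (\<nu> k) - \<E> \<nu>star) \<le> C * ln (real T) / sqrt (real T)"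
    unfolding \<E>_def
  proof (rule mirror_descent_rate[where \<eta> = "\<lambda>T k. 1 / sqrt (real k + 1)"])
    \<comment> \<open>The squared steps form a harmonic sum; for the constant steps below, the
      squares add up to 1.\<close>
    show "(\<Sum>k<T. (1 / sqrt (real k + 1))\<^sup>2) \<le> 1 + ln (real T)" if "2 \<le> T" for T
      using sum_inverse_Suc_le[of T] that by (simp add: power_divide)
  qed (fact assms \<sigma> \<nu>0 | simp add: frac_le)+
  moreover have "\<exists>C. \<forall>T\<ge>2. \<forall>\<nu> \<rho>. mirror_descent_run \<Omega> n w m u x \<rho>0 (\<lambda>k. 1 / sqrt (real T)) T \<nu> \<rho> \<longrightarrow>
      (MIN k\<in>{0..T}. \<E> (\<nu> k) - \<E> \<nu>star) \<le> C * ln (real T) / sqrt (real T)"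
    unfolding \<E>_def
  proof (rule mirror_descent_rate[where \<eta> = "\<lambda>T k. 1 / sqrt (real T)"])
    \<comment> \<open>At \<open>T = 0\<close> the quotient is 0 by the convention for division by
      zero.\<close>
    show "1 / sqrt (real T) \<le> 1" for T by (cases "T = 0") auto
  qed (fact assms \<sigma> \<nu>0 | simp add: power_divide)+
  moreover have "2 \<le> T" if "max 2 (4 * real DIM('a) / r\<^sup>2) \<le> real T" for T :: nat
    using that by simp
  ultimately show ?thesis by meson
qed

end
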